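(* Let $n\geq 1$. List the set of partitions of $n$ in weakly increasing order of crank, and separately in weakly increasing order of rank; ties may be broken arbitrarily in each list. Define $\tau_n$ as the bijection on the set of partitions of $n$ that sends the $i$-th partition in the crank-ordered list to the $i$-th partition in the rank-ordered list. Then for every partition $\lambda$ of $n$, \[ \operatorname{crank}(\lambda)-\operatorname{rank}(\tau_n(\lambda))=\begin{cases}0 & \text{if } \operatorname{crank}(\lambda)=0,\\ 0\text{ or }1 & \text{if } \operatorname{crank}(\lambda)>0,\\ 0\text{ or }-1 & \text{if } \operatorname{crank}(\lambda)<0.\end{cases} \]
   Context: For a partition $\lambda$, $\operatorname{rank}(\lambda)$ is its largest part minus its number of parts. $\operatorname{crank}(\lambda)$ is the largest part of $\lambda$ if $\lambda$ contains no part equal to $1$; otherwise it is the number of parts larger than the number of ones minus the number of ones. *)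

theory Defs
  imports Main "HOL-Library.Multiset"
begin

definition partitions :: "nat \<Rightarrow> nat multiset set" where
  "partitions n = {M. 0 \<notin># M \<and> sum_mset M = n}"

definition largest_part :: "nat multiset \<Rightarrow> nat" where
  "largest_part M = (if M = {#} then 0 else Max_mset M)"

definition rank :: "nat multiset \<Rightarrow> int" where
  "rank M = int (largest_part M) - int (size M)"

definition crank :: "nat multiset \<Rightarrow> int" where
  "crank M = (let w = count M 1 in
     if w = 0 then int (largest_part M)
     else int (size (filter_mset (\<lambda>x. x > w) M)) - int w)"

end

theory Submission
  imports Defs "HOL-Library.Equipollence"
begin

text \<open>
  By symmetry of rank and crank, the claim amounts to two inequalities for all \<open>a \<ge> 0\<close>:
  #(rank \<open>\<ge> a + 1\<close>) \<open>\<le>\<close> #(crank \<open>\<ge> a + 1\<close>) \<open>\<le>\<close> #(rank \<open>\<ge> a\<close>).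
  Cut a partition along its Durfee rectangle with \<open>j\<close> rows and \<open>j + a\<close> columns; let \<open>x\<close> be the
  columns to the right of the rectangle and \<open>y\<close> the rows below it. The rank is \<open>a + |x| - |y|\<close>, and
  both the partitions with crank \<open>\<ge> a + 1\<close> and those with crank \<open>\<le> -(a + 1)\<close> are
  equinumerous to the pairs in which no column of \<open>x\<close> has the full height \<open>j\<close>.

  For the first inequality, the triples with \<open>|x| > |y|\<close> and \<open>j \<in> x\<close> have to be injected into those
  with \<open>|x| \<le> |y|\<close> and \<open>j \<notin> x\<close>. Decrementing \<open>x\<close> and incrementing \<open>y\<close> matches most of them and leaves,
  on both sides, triples with \<open>|x| = |y| + 1\<close>. These are treated by a lattice-path argument (exchange
  the initial segments of \<open>x\<close> and \<open>y\<close> up to their first crossing), followed by adding or removing a few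
  parts so that \<open>j\<close> changes by at most one; the cases \<open>a = 0\<close>, \<open>a = 1\<close> and \<open>a \<ge> 2\<close> differ.

  The second inequality follows from the first at \<open>a + 1\<close>, because the number of partitions of \<open>n\<close> is
  the number of those with rank \<open>\<le> a + 2\<close> plus those with rank \<open>\<ge> a + 3\<close>, Dyson's bijection turns
  the former into partitions of \<open>n + a + 1\<close> with rank \<open>\<ge> a\<close>, and the cranks satisfy a similar
  recurrence with \<open>a + 1\<close> in place of \<open>a + 3\<close>.
\<close>

section \<open>Conjugation\<close>

text \<open>For \<open>1 \<le> j\<close> this is the \<open>j\<close>-th part of the conjugate
  partition.\<close>

definition tail_count :: "nat multiset \<Rightarrow> nat \<Rightarrow> nat" where
  "tail_count x j = size (filter_mset (\<lambda>p. j \<le> p) x)"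

lemma tail_count_simps [simp]:
  "tail_count {#} j = 0"
  "tail_count (add_mset p x) j = tail_count x j + (if j \<le> p then 1 else 0)"
  "tail_count (x + y) j = tail_count x j + tail_count y j"
  "tail_count (replicate_mset n p) j = (if j \<le> p then n else 0)"
proof -
  show "tail_count (replicate_mset n p) j = (if j \<le> p then n else 0)"
    by (induction n) (auto simp: tail_count_def)
qed (auto simp: tail_count_def)

lemma tail_count_antimono: "i \<le> j \<Longrightarrow> tail_count x j \<le> tail_count x i"
  by (induction x) auto

lemma tail_count_Suc: "tail_count x j = count x j + tail_count x (Suc j)"
  by (induction x) auto

lemma tail_count_le_size: "tail_count x j \<le> size x"
  by (induction x) auto

lemma tail_count_pos_iff: "0 < tail_count x j \<longleftrightarrow> (\<exists>p\<in>#x. j \<le> p)"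
  by (induction x) auto

lemma multiset_eq_tail_count:
  assumes "0 \<notin># x" "0 \<notin># y" "\<And>j. 1 \<le> j \<Longrightarrow> tail_count x j = tail_count y j"
  shows "x = y"
proof (rule multiset_eqI)
  fix p show "count x p = count y p"
  proof (cases p)
    case 0
    then show ?thesis using assms(1,2) by (metis not_in_iff)
  next
    case (Suc q)
    then show ?thesis
      using assms(3)[of p] assms(3)[of "Suc p"] tail_count_Suc[of x p] tail_count_Suc[of y p] by simp
  qed
qed

lemma largest_part_le_iff: "largest_part x \<le> m \<longleftrightarrow> (\<forall>p\<in>#x. p \<le> m)"
  by (auto simp: largest_part_def)

lemma largest_part_ge_iff: "1 \<le> m \<Longrightarrow> m \<le> largest_part x \<longleftrightarrow> (\<exists>p\<in>#x. m \<le> p)"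
proof -
  assume "1 \<le> m"
  then have "m \<le> z \<longleftrightarrow> \<not> z \<le> m - 1" for z by linarith
  then show ?thesis using largest_part_le_iff[of x "m - 1"] by simp
qed

lemma set_mset_le_iff: "set_mset x \<subseteq> {Suc 0..m} \<longleftrightarrow> 0 \<notin># x \<and> largest_part x \<le> m"
  by (auto simp: largest_part_le_iff subset_iff Suc_le_eq intro!: gr0I)

definition conj_mset :: "nat multiset \<Rightarrow> nat multiset" where
  "conj_mset x = image_mset (tail_count x) (mset_set {1..largest_part x})"

lemma zero_notin_conj: "0 \<notin># conj_mset x"
proof
  assume "0 \<in># conj_mset x"
  then obtain j where "1 \<le> j" "j \<le> largest_part x" "tail_count x j = 0"
    by (auto simp: conj_mset_def)
  then show False using largest_part_ge_iff[of j x] tail_count_pos_iff[of x j] by auto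
qed

lemma size_conj: "size (conj_mset x) = largest_part x"
  by (simp add: conj_mset_def)

lemma tail_count_conj:
  assumes "1 \<le> i"
  shows "tail_count (conj_mset x) i = card {j. 1 \<le> j \<and> i \<le> tail_count x j}"
proof -
  have "filter_mset (\<lambda>p. i \<le> p) (conj_mset x)
      = image_mset (tail_count x) (filter_mset (\<lambda>j. i \<le> tail_count x j) (mset_set {1..largest_part x}))"
    by (simp add: conj_mset_def filter_mset_image_mset)
  also have "filter_mset (\<lambda>j. i \<le> tail_count x j) (mset_set {1..largest_part x})
      = mset_set {j \<in> {1..largest_part x}. i \<le> tail_count x j}"
    by simp
  also have "{j \<in> {1..largest_part x}. i \<le> tail_count x j} = {j. 1 \<le> j \<and> i \<le> tail_count x j}"
    using assms largest_part_ge_iff[of _ x] tail_count_pos_iff[of x] by fastforce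
  finally show ?thesis by (simp add: tail_count_def)
qed

text \<open>Both \<open>i \<le> tail_count x j\<close> and
  \<open>j \<le> tail_count (conj_mset x) i\<close> say that the diagram of \<open>x\<close> has a
  cell in row \<open>i\<close> and column \<open>j\<close>, and tail counts determine positive
  parts.\<close>

lemma conj_conj:
  assumes "0 \<notin># x"
  shows "conj_mset (conj_mset x) = x"
proof (rule multiset_eq_tail_count[OF zero_notin_conj assms])
  fix j :: nat assume j: "1 \<le> j"
  have "i \<le> tail_count x j \<longleftrightarrow> j \<le> tail_count (conj_mset x) i" if i: "1 \<le> i" for i
  proof
    assume "i \<le> tail_count x j"
    then have "{1..j} \<subseteq> {j'. 1 \<le> j' \<and> i \<le> tail_count x j'}"
      using tail_count_antimono[of _ j x] by fastforce
    moreover have fin: "finite {j'. 1 \<le> j' \<and> i \<le> tail_count x j'}"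
      by (rule finite_subset[of _ "{..largest_part x}"])
         (use i largest_part_ge_iff[of _ x] tail_count_pos_iff[of x] in fastforce)+
    ultimately have "card {1..j} \<le> card {j'. 1 \<le> j' \<and> i \<le> tail_count x j'}" by (metis card_mono)
    then show "j \<le> tail_count (conj_mset x) i" by (simp add: tail_count_conj[OF i])
  next
    assume *: "j \<le> tail_count (conj_mset x) i"
    show "i \<le> tail_count x j"
    proof (rule ccontr)
      assume "\<not> i \<le> tail_count x j"
      then have "{j'. 1 \<le> j' \<and> i \<le> tail_count x j'} \<subseteq> {1..<j}"
        using tail_count_antimono[of j _ x] by (fastforce simp: not_le)
      then have "card {j'. 1 \<le> j' \<and> i \<le> tail_count x j'} \<le> card {1..<j}"
        by (rule card_mono[rotated]) simp
      then show False using * j by (simp add: tail_count_conj[OF i])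
    qed
  qed
  then have "{i. 1 \<le> i \<and> j \<le> tail_count (conj_mset x) i} = {1..tail_count x j}" by auto
  then show "tail_count (conj_mset (conj_mset x)) j = tail_count x j"
    by (simp add: tail_count_conj[OF j])
qed

lemma sum_tail_count: "\<forall>p\<in>#x. p \<le> m \<Longrightarrow> (\<Sum>j = 1..m. tail_count x j) = sum_mset x"
proof (induction x)
  case (add p x)
  have "(\<Sum>j = 1..m. if j \<le> p then 1 else 0) = card ({1..m} \<inter> {j. j \<le> p})"
    by (simp add: sum.If_cases)
  also have "{1..m} \<inter> {j. j \<le> p} = {1..p}" using add(2) by auto
  finally show ?case using add by (simp add: sum.distrib)
qed simp

lemma sum_conj: "sum_mset (conj_mset x) = sum_mset x"
proof -
  have "sum_mset (conj_mset x) = (\<Sum>j = 1..largest_part x. tail_count x j)"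
    by (simp add: conj_mset_def sum_unfold_sum_mset)
  moreover have "\<forall>p\<in>#x. p \<le> largest_part x" using largest_part_le_iff by blast
  ultimately show ?thesis by (simp only: sum_tail_count)
qed

lemma largest_part_conj: "0 \<notin># x \<Longrightarrow> largest_part (conj_mset x) = size x"
  by (metis conj_conj size_conj)

section \<open>Durfee rectangles\<close>

text \<open>The partition whose diagram consists of an \<open>r \<times> c\<close> rectangle, the columns \<open>x\<close> to its right and
  the rows \<open>y\<close> below it.\<close>

definition assemble :: "nat \<Rightarrow> nat \<Rightarrow> nat multiset \<Rightarrow> nat multiset \<Rightarrow> nat multiset" where
  "assemble r c x y =
     y + image_mset (\<lambda>p. p + c) (conj_mset x) + replicate_mset (r - largest_part x) c"

lemma sum_image_add: "sum_mset (image_mset (\<lambda>p. p + c) x) = sum_mset x + size x * (c::nat)"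
  by (induction x) auto

lemma size_assemble: "largest_part x \<le> r \<Longrightarrow> size (assemble r c x y) = size y + r"
  by (simp add: assemble_def size_conj)

lemma sum_assemble:
  "largest_part x \<le> r \<Longrightarrow> sum_mset (assemble r c x y) = r * c + sum_mset x + sum_mset y"
  by (simp add: assemble_def sum_image_add size_conj sum_conj flip: add_mult_distrib)

lemma zero_notin_assemble: "0 \<notin># y \<Longrightarrow> 1 \<le> c \<Longrightarrow> 0 \<notin># assemble r c x y"
  using zero_notin_conj[of x] by (auto simp: assemble_def in_replicate_mset)

lemma count_assemble:
  "p < c \<Longrightarrow> count (assemble r c x y) p = count y p"
  by (auto simp: assemble_def count_image_mset not_in_iff[symmetric])

text \<open>Together with \<open>tail_count_assemble_gt\<close> this pins down the rectangle:
  columns up to \<open>c\<close> have height at least \<open>r\<close>, later ones at most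
  \<open>r\<close>.\<close>

lemma tail_count_assemble_le:
  assumes "largest_part x \<le> r" "j \<le> c"
  shows "r \<le> tail_count (assemble r c x y) j"
proof -
  have "tail_count (image_mset (\<lambda>p. p + c) z) j = size z" for z
    using assms(2) by (induction z) auto
  then show ?thesis using assms by (simp add: assemble_def size_conj)
qed

lemma tail_count_assemble_gt:
  assumes "largest_part x \<le> r" "c < j" "largest_part y \<le> c"
  shows "tail_count (assemble r c x y) j \<le> r"
proof -
  have "tail_count y j = 0"
    using assms(2,3) tail_count_pos_iff[of y j] by (auto simp: largest_part_le_iff)
  moreover have "tail_count (image_mset (\<lambda>p. p + c) (conj_mset x)) j \<le> r"
    using tail_count_le_size[of "image_mset (\<lambda>p. p + c) (conj_mset x)" j] assms(1)
    by (simp add: size_conj)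
  ultimately show ?thesis using assms(2) by (simp add: assemble_def)
qed

lemma largest_part_assemble:
  assumes "largest_part x \<le> r" "1 \<le> r" "largest_part y \<le> c" "0 \<notin># x"
  shows "largest_part (assemble r c x y) = c + size x"
proof (rule antisym)
  have conj: "p \<le> size x" if "p \<in># conj_mset x" for p
    using that largest_part_conj[OF assms(4)] largest_part_le_iff by (metis order_refl)
  show "largest_part (assemble r c x y) \<le> c + size x"
    using assms(3) conj by (fastforce simp: largest_part_le_iff assemble_def in_replicate_mset)
  show "c + size x \<le> largest_part (assemble r c x y)"
  proof (cases "x = {#}")
    case True
    then have "c \<in># assemble r c x y" using assms(2) by (simp add: assemble_def largest_part_def)
    then show ?thesis using True largest_part_le_iff by auto
  next
    case False
    then have "1 \<le> size x" by (simp add: Suc_le_eq nonempty_has_size)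
    then obtain p where "p \<in># conj_mset x" "size x \<le> p"
      using largest_part_conj[OF assms(4)] largest_part_ge_iff[of "size x" "conj_mset x"] by auto
    then have "p + c \<in># assemble r c x y" by (auto simp: assemble_def)
    then have "p + c \<le> largest_part (assemble r c x y)" using largest_part_le_iff by blast
    then show ?thesis using \<open>size x \<le> p\<close> by simp
  qed
qed

text \<open>The parts exceeding \<open>c\<close> are exactly the rows that meet the columns
  \<open>x\<close>, so they give back \<open>conj_mset x\<close>, hence \<open>x\<close>;
  cancellation leaves \<open>y\<close>.\<close>

lemma assemble_inject:
  assumes "assemble r c x y = assemble r c x' y'"
    and "largest_part y \<le> c" "largest_part y' \<le> c" "0 \<notin># x" "0 \<notin># x'"
  shows "x = x' \<and> y = y'"
proof -
  have *: "filter_mset (\<lambda>p. c < p) (assemble r c x y) = image_mset (\<lambda>p. p + c) (conj_mset x)"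
    if "largest_part y \<le> c" for x y
  proof -
    have "filter_mset (\<lambda>p. c < p) y = {#}"
      using that by (auto simp: filter_mset_eq_mempty_iff largest_part_le_iff)
    moreover have "filter_mset (\<lambda>p. c < p) (image_mset (\<lambda>p. p + c) (conj_mset x)) = image_mset (\<lambda>p. p + c) (conj_mset x)"
      using zero_notin_conj[of x] by (auto simp: filter_mset_eq_conv intro!: gr0I)
    moreover have "filter_mset (\<lambda>p. c < p) (replicate_mset k c) = {#}" for k
      by (auto simp: filter_mset_eq_mempty_iff in_replicate_mset)
    ultimately show ?thesis by (simp add: assemble_def)
  qed
  have "image_mset (\<lambda>p. p + c) (conj_mset x) = image_mset (\<lambda>p. p + c) (conj_mset x')"
    using assms(1) *[OF assms(2), of x] *[OF assms(3), of x'] by simp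
  then have "image_mset (\<lambda>p. p - c) (image_mset (\<lambda>p. p + c) (conj_mset x))
      = image_mset (\<lambda>p. p - c) (image_mset (\<lambda>p. p + c) (conj_mset x'))" by simp
  then have "conj_mset x = conj_mset x'" by (simp add: multiset.map_comp comp_def)
  then have "x = x'" using assms(4,5) by (metis conj_conj)
  with assms(1) show ?thesis by (simp add: assemble_def)
qed

lemma assemble_surj:
  assumes "0 \<notin># l" "tail_count l (Suc c) \<le> r" "r \<le> tail_count l c" "1 \<le> c"
  obtains x y where "set_mset x \<subseteq> {1..r}" "set_mset y \<subseteq> {1..c}" "assemble r c x y = l"
proof -
  \<comment> \<open>Of the parts equal to \<open>c\<close>, those beyond the first \<open>r\<close>
    parts of \<open>l\<close> lie below the rectangle.\<close>
  define y where "y = filter_mset (\<lambda>p. p < c) l + replicate_mset (tail_count l c - r) c"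
  define u where "u = image_mset (\<lambda>p. p - c) (filter_mset (\<lambda>p. c < p) l)"
  define x where "x = conj_mset u"
  have u0: "0 \<notin># u" by (auto simp: u_def)
  have su: "size u = tail_count l (Suc c)" by (simp add: u_def tail_count_def Suc_le_eq)
  have lx: "largest_part x = tail_count l (Suc c)" by (simp add: x_def largest_part_conj[OF u0] su)
  have "set_mset x \<subseteq> {1..r}"
    using lx assms(2) zero_notin_conj[of u] by (simp add: set_mset_le_iff x_def)
  moreover have "set_mset y \<subseteq> {1..c}"
    using assms(1,4) by (auto simp: y_def in_replicate_mset Suc_le_eq intro!: gr0I)
  moreover have "assemble r c x y = l"
  proof -
    have "image_mset (\<lambda>p. p + c) (conj_mset x) = filter_mset (\<lambda>p. c < p) l"
    proof -
      have "image_mset (\<lambda>p. p + c) u = image_mset (\<lambda>p. p) (filter_mset (\<lambda>p. c < p) l)"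
        unfolding u_def multiset.map_comp by (rule image_mset_cong) auto
      then show ?thesis by (simp add: x_def conj_conj[OF u0])
    qed
    moreover have "tail_count l c - r + (r - tail_count l (Suc c)) = count l c"
      using assms(2,3) tail_count_Suc[of l c] by simp
    ultimately have "count (assemble r c x y) p = count l p" for p
      by (cases p c rule: linorder_cases) (simp_all add: assemble_def y_def lx)
    then show ?thesis by (rule multiset_eqI)
  qed
  ultimately show thesis by (rule that)
qed

text \<open>Triples \<open>(j, x, y)\<close> stand for partitions with Durfee rectangle \<open>(j + c1) \<times> (j + c2)\<close>; the lower
  bound \<open>j0\<close> serves to exclude degenerate rectangles without columns.\<close>

definition durf :: "nat \<Rightarrow> nat \<Rightarrow> nat \<Rightarrow> nat \<Rightarrow> (nat \<times> nat multiset \<times> nat multiset) set" where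
  "durf c1 c2 j0 n = {(j, x, y). j0 \<le> j \<and> set_mset x \<subseteq> {1..j + c1} \<and> set_mset y \<subseteq> {1..j + c2}
     \<and> (j + c1) * (j + c2) + sum_mset x + sum_mset y = n}"

definition of_durf :: "nat \<Rightarrow> nat \<Rightarrow> nat \<times> nat multiset \<times> nat multiset \<Rightarrow> nat multiset" where
  "of_durf c1 c2 = (\<lambda>(j, x, y). assemble (j + c1) (j + c2) x y)"

text \<open>The partition determines \<open>j\<close> as the largest number with
  \<open>j + c1 \<le> tail_count l (j + c2)\<close>; the condition on \<open>l\<close> says that
  \<open>j0\<close> qualifies.\<close>

lemma bij_betw_of_durf:
  assumes "1 \<le> j0 + c2"
  shows "bij_betw (of_durf c1 c2) (durf c1 c2 j0 n)
    {l \<in> partitions n. j0 + c1 \<le> tail_count l (j0 + c2)}"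
  unfolding bij_betw_def
proof
  show "inj_on (of_durf c1 c2) (durf c1 c2 j0 n)"
  proof (rule inj_onI)
    fix s t assume s: "s \<in> durf c1 c2 j0 n" and t: "t \<in> durf c1 c2 j0 n"
      and eq: "of_durf c1 c2 s = of_durf c1 c2 t"
    obtain j x y j' x' y' where st: "s = (j, x, y)" "t = (j', x', y')" by (metis prod_cases3)
    have r: "0 \<notin># x" "largest_part x \<le> j + c1" "0 \<notin># y" "largest_part y \<le> j + c2"
      "0 \<notin># x'" "largest_part x' \<le> j' + c1" "0 \<notin># y'" "largest_part y' \<le> j' + c2"
      using s t by (auto simp: st durf_def set_mset_le_iff)
    \<comment> \<open>If \<open>j < j'\<close>, column \<open>j' + c2\<close> has height at most
      \<open>j + c1\<close> by the first description, but at least \<open>j' + c1\<close> by the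
      second.\<close>
    have *: "\<not> j < j'" if "largest_part x \<le> j + c1" "largest_part y \<le> j + c2"
      "largest_part x' \<le> j' + c1"
      "assemble (j + c1) (j + c2) x y = assemble (j' + c1) (j' + c2) x' y'" for j j' x y x' y'
    proof
      assume "j < j'"
      then show False
        using tail_count_assemble_gt[of x "j + c1" "j + c2" "j' + c2" y]
          tail_count_assemble_le[of x' "j' + c1" "j' + c2" "j' + c2" y'] that by simp
    qed
    have eq': "assemble (j + c1) (j + c2) x y = assemble (j' + c1) (j' + c2) x' y'"
      using eq by (simp add: of_durf_def st)
    have "j = j'" using *[of x j y x' j' y'] *[of x' j' y' x j y] r eq' by (simp add: not_less)
    then show "s = t" using assemble_inject[of "j + c1" "j + c2" x y x' y'] eq' r by (simp add: st)
  qed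
  show "of_durf c1 c2 ` durf c1 c2 j0 n = {l \<in> partitions n. j0 + c1 \<le> tail_count l (j0 + c2)}"
  proof (intro equalityI subsetI)
    fix l assume "l \<in> of_durf c1 c2 ` durf c1 c2 j0 n"
    then obtain j x y where l: "l = assemble (j + c1) (j + c2) x y" and t: "(j, x, y) \<in> durf c1 c2 j0 n"
      by (auto simp: of_durf_def)
    then have r: "0 \<notin># x" "largest_part x \<le> j + c1" "0 \<notin># y" "largest_part y \<le> j + c2" "j0 \<le> j"
      and n: "(j + c1) * (j + c2) + sum_mset x + sum_mset y = n"
      by (auto simp: durf_def set_mset_le_iff)
    have "j + c1 \<le> tail_count l (j0 + c2)"
      unfolding l using r by (intro tail_count_assemble_le) auto
    then show "l \<in> {l \<in> partitions n. j0 + c1 \<le> tail_count l (j0 + c2)}"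
      using r n assms zero_notin_assemble[of y "j + c2" "j + c1" x] sum_assemble[of x "j + c1" "j + c2" y]
      by (auto simp: partitions_def l)
  next
    fix l assume l: "l \<in> {l \<in> partitions n. j0 + c1 \<le> tail_count l (j0 + c2)}"
    define P where "P = (\<lambda>j. j + c1 \<le> tail_count l (j + c2))"
    have "P j0" using l by (simp add: P_def)
    moreover have bound: "\<forall>j. P j \<longrightarrow> j \<le> size l"
      using tail_count_le_size[of l] by (auto simp: P_def intro: le_trans add_leD1)
    ultimately have "P (Greatest P)" "j0 \<le> Greatest P" "\<not> P (Suc (Greatest P))"
      using GreatestI_nat[of P j0 "size l"] Greatest_le_nat[of P _ "size l"] by (blast, blast, force)
    then obtain j where j: "j0 \<le> j" "j + c1 \<le> tail_count l (j + c2)" "tail_count l (Suc (j + c2)) \<le> j + c1"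
      by (auto simp: P_def not_le)
    have l0: "0 \<notin># l" "sum_mset l = n" using l by (auto simp: partitions_def)
    obtain x y where xy: "set_mset x \<subseteq> {1..j + c1}" "set_mset y \<subseteq> {1..j + c2}"
      "assemble (j + c1) (j + c2) x y = l"
      using assemble_surj[OF l0(1) j(3,2)] j(1) assms by auto
    then have "(j, x, y) \<in> durf c1 c2 j0 n"
      using j(1) l0(2) sum_assemble[of x "j + c1" "j + c2" y]
      by (auto simp: durf_def set_mset_le_iff)
    then show "l \<in> of_durf c1 c2 ` durf c1 c2 j0 n"
      using xy(3) by (force simp: of_durf_def)
  qed
qed

section \<open>Exchanging initial segments\<close>

text \<open>Two weakly decreasing sequences, read as lattice paths, exchange their initial segments up to
  the first index where they cross; \<open>b\<close> bounds the entries of the first sequence. The shift by one makes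
  the ranges of the parts move towards each other.\<close>

fun head_swap :: "nat \<Rightarrow> nat list \<Rightarrow> nat list \<Rightarrow> nat list \<times> nat list" where
  "head_swap b (x # xs) (y # ys) =
     (if y \<le> Suc b then (x # xs, y # ys)
      else (case head_swap x xs ys of (p, q) \<Rightarrow> ((y - 1) # p, Suc x # q)))"
| "head_swap b xs ys = (xs, ys)"

text \<open>Inverts \<open>head_swap\<close>: an exchanged head \<open>y - 1\<close> exceeds
  \<open>b\<close> because \<open>y > Suc b\<close>, while an untouched head is at most
  \<open>b\<close>. So \<open>p \<le> b\<close> detects where the exchange stopped.\<close>

fun head_unswap :: "nat \<Rightarrow> nat list \<Rightarrow> nat list \<Rightarrow> nat list \<times> nat list" where
  "head_unswap b (p # ps) (q # qs) =
     (if p \<le> b then (p # ps, q # qs)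
      else (case head_unswap (q - 1) ps qs of (xs, ys) \<Rightarrow> ((q - 1) # xs, Suc p # ys)))"
| "head_unswap b ps qs = (ps, qs)"

lemma head_swap_nil [simp]: "head_swap b xs [] = (xs, [])"
  by (cases xs) auto

lemma head_unswap_nil [simp]: "head_unswap b xs [] = (xs, [])"
  by (cases xs) auto

text \<open>Each exchange preserves \<open>x + y\<close>. It stops at the first
  \<open>y \<le> Suc b\<close> for the current \<open>b\<close>, and later entries of
  \<open>ys\<close> are no larger. The extra entry of \<open>xs\<close> keeps \<open>xs\<close> from
  running out first.\<close>

lemma head_swap_basic:
  assumes "head_swap b xs ys = (p, q)" "length xs = Suc (length ys)"
    and "sorted_wrt (\<ge>) xs" "set xs \<subseteq> {1..b}"
    and "sorted_wrt (\<ge>) ys" "set ys \<subseteq> {1..c}"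
  shows "length p = length xs \<and> length q = length ys
    \<and> sum_list p + sum_list q = sum_list xs + sum_list ys
    \<and> set p \<subseteq> {1..max b (c - 1)} \<and> set q \<subseteq> {1..Suc b}"
  using assms
proof (induction b xs ys arbitrary: p q c rule: head_swap.induct)
  case (1 b x xs y ys)
  show ?case
  proof (cases "y \<le> Suc b")
    case True
    then have "p = x # xs" "q = y # ys" using 1(2) by auto
    moreover have "set (y # ys) \<subseteq> {1..Suc b}"
      using 1(6,7) True by fastforce
    moreover have "set (x # xs) \<subseteq> {1..max b (c - 1)}"
      using 1(5) by fastforce
    ultimately show ?thesis by simp
  next
    case False
    obtain p' q' where pq: "head_swap x xs ys = (p', q')" by (cases "head_swap x xs ys")
    have eq: "p = (y - 1) # p'" "q = Suc x # q'" using False 1(2) pq by auto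
    have xb: "1 \<le> x" "x \<le> b" and yc: "y \<le> c" using 1(5,7) by auto
    have xs: "set xs \<subseteq> {1..x}" using 1(4,5) by fastforce
    have "length p' = length xs \<and> length q' = length ys
      \<and> sum_list p' + sum_list q' = sum_list xs + sum_list ys
      \<and> set p' \<subseteq> {1..max x (c - 1)} \<and> set q' \<subseteq> {1..Suc x}"
      using 1(1)[OF False pq _ _ xs, of c] 1(3-7) by auto
    moreover from this have "set p' \<subseteq> {1..max b (c - 1)}" "set q' \<subseteq> {1..Suc b}"
      using xb by fastforce+
    ultimately show ?thesis using False xb yc unfolding eq by auto
  qed
qed (auto simp: le_max_iff_disj subset_iff)

lemma count_list_all: "set xs \<subseteq> {a} \<Longrightarrow> count_list xs a = length xs"
  by (induction xs) auto

text \<open>After an exchange, later entries of \<open>p\<close> are at most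
  \<open>max x (y - 1) = y - 1\<close>, since \<open>x \<le> b < y - 1\<close>, and later entries of
  \<open>q\<close> at most \<open>Suc x\<close>; so both lists stay decreasing.\<close>

lemma head_swap_inverse:
  assumes "head_swap b xs ys = (p, q)" "length xs = Suc (length ys)"
    and "sorted_wrt (\<ge>) xs" "set xs \<subseteq> {1..b}"
    and "sorted_wrt (\<ge>) ys" "set ys \<subseteq> {1..}"
  shows "sorted_wrt (\<ge>) p \<and> sorted_wrt (\<ge>) q \<and> head_unswap b p q = (xs, ys)"
  using assms
proof (induction b xs ys arbitrary: p q rule: head_swap.induct)
  case (1 b x xs y ys)
  show ?case
  proof (cases "y \<le> Suc b")
    case True
    then show ?thesis using 1 by auto
  next
    case False
    obtain p' q' where pq: "head_swap x xs ys = (p', q')" by (cases "head_swap x xs ys")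
    have eq: "p = (y - 1) # p'" "q = Suc x # q'" using False 1(2) pq by auto
    have xb: "1 \<le> x" "x \<le> b" using 1(5) by auto
    have xs: "set xs \<subseteq> {1..x}" and ys: "set ys \<subseteq> {1..y}" using 1(4-7) by fastforce+
    have IH: "sorted_wrt (\<ge>) p' \<and> sorted_wrt (\<ge>) q' \<and> head_unswap x p' q' = (xs, ys)"
      using 1(1)[OF False pq _ _ xs] 1(3-7) by auto
    have "set p' \<subseteq> {1..max x (y - 1)} \<and> set q' \<subseteq> {1..Suc x}"
      using head_swap_basic[OF pq _ _ xs _ ys] 1(3-7) by auto
    then have "\<forall>z\<in>set p'. z \<le> y - 1" "\<forall>z\<in>set q'. z \<le> Suc x" using False xb by fastforce+
    then show ?thesis using IH False xb unfolding eq by auto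
  qed
qed auto

text \<open>If \<open>Suc b < c\<close>, all entries \<open>c\<close> of \<open>ys\<close> are
  exchanged and become \<open>c - 1\<close>, and nothing else in \<open>p\<close> is that large.
  Ones of \<open>ys\<close> are never exchanged, and exchanged entries of \<open>xs\<close> become
  at least \<open>2\<close>. A new \<open>2\<close> in \<open>q\<close> comes from a
  \<open>1\<close> of \<open>xs\<close>; from there on \<open>xs\<close> has only ones and is longer
  than what is left of \<open>ys\<close>.\<close>

lemma head_swap_counts:
  assumes "head_swap b xs ys = (p, q)" "length xs = Suc (length ys)"
    and "sorted_wrt (\<ge>) xs" "set xs \<subseteq> {1..b}"
    and "sorted_wrt (\<ge>) ys" "set ys \<subseteq> {1..c}"
  shows "(Suc b < c \<longrightarrow> count_list p (c - 1) = count_list ys c)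
    \<and> count_list q 1 = count_list ys 1
    \<and> (2 \<in> set q \<longrightarrow> 2 \<notin> set ys \<longrightarrow> count_list ys 1 + 2 \<le> count_list xs 1)"
  using assms
proof (induction b xs ys arbitrary: p q rule: head_swap.induct)
  case (1 b x xs y ys)
  show ?case
  proof (cases "y \<le> Suc b")
    case True
    then have eq: "p = x # xs" "q = y # ys" using 1(2) by auto
    have "count_list p (c - 1) = 0 \<and> count_list (y # ys) c = 0" if "Suc b < c"
    proof -
      have "c - 1 \<notin> set (x # xs)" "c \<notin> set (y # ys)" using 1(5,6) True that by fastforce+
      then show ?thesis unfolding eq by (metis count_notin)
    qed
    then show ?thesis unfolding eq by auto
  next
    case False
    obtain p' q' where pq: "head_swap x xs ys = (p', q')" by (cases "head_swap x xs ys")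
    have eq: "p = (y - 1) # p'" "q = Suc x # q'" using False 1(2) pq by auto
    have xb: "1 \<le> x" "x \<le> b" using 1(5) by auto
    have xs: "set xs \<subseteq> {1..x}" and ys: "set ys \<subseteq> {1..c}" using 1(4-7) by fastforce+
    have IH: "(Suc x < c \<longrightarrow> count_list p' (c - 1) = count_list ys c)
      \<and> count_list q' 1 = count_list ys 1
      \<and> (2 \<in> set q' \<longrightarrow> 2 \<notin> set ys \<longrightarrow> count_list ys 1 + 2 \<le> count_list xs 1)"
      using 1(1)[OF False pq _ _ xs] 1(3-7) by auto
    have "count_list ys 1 + 2 \<le> count_list (x # xs) 1" if "x = 1"
    proof -
      have "set xs \<subseteq> {1}" using xs that by auto
      then have "count_list xs 1 = length xs" by (rule count_list_all)
      moreover have "count_list ys 1 \<le> length ys" by (rule count_le_length)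
      ultimately show ?thesis using that 1(3) by simp
    qed
    then show ?thesis using IH False xb unfolding eq by auto
  qed
qed (fastforce simp: subset_iff intro!: count_notin)+

section \<open>The exchange on multisets\<close>

definition desc :: "nat multiset \<Rightarrow> nat list" where
  "desc M = rev (sorted_list_of_multiset M)"

lemma desc_simps [simp]:
  "mset (desc M) = M" "sorted_wrt (\<ge>) (desc M)" "length (desc M) = size M"
  "set (desc M) = set_mset M" "sum_list (desc M) = sum_mset M" "count_list (desc M) k = count M k"
proof -
  show *: "mset (desc M) = M" by (simp add: desc_def)
  show "sorted_wrt (\<ge>) (desc M)" by (simp add: desc_def sorted_wrt_rev)
  show "length (desc M) = size M" "set (desc M) = set_mset M" "sum_list (desc M) = sum_mset M"
    "count_list (desc M) k = count M k"
    by (metis * size_mset, metis * set_mset_mset, metis * sum_mset_sum_list, metis * count_mset)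
qed

lemma desc_mset: "sorted_wrt (\<ge>) xs \<Longrightarrow> desc (mset xs) = xs"
  unfolding desc_def
  by (metis rev_rev_ident mset_rev sorted_list_of_multiset_mset sorted_sort_id sorted_wrt_rev)

definition swap :: "nat \<Rightarrow> nat multiset \<times> nat multiset \<Rightarrow> nat multiset \<times> nat multiset" where
  "swap b = (\<lambda>(x, y). map_prod mset mset (head_swap b (desc x) (desc y)))"

lemma swap_props:
  assumes "swap b (x, y) = (p, q)" "size x = Suc (size y)"
    and "set_mset x \<subseteq> {1..b}" "set_mset y \<subseteq> {1..c}"
  shows "size p = size x" "size q = size y" "sum_mset p + sum_mset q = sum_mset x + sum_mset y"
    "set_mset p \<subseteq> {1..max b (c - 1)}" "set_mset q \<subseteq> {1..Suc b}"
    "Suc b < c \<Longrightarrow> count p (c - 1) = count y c"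
    "count q 1 = count y 1"
    "2 \<in># q \<Longrightarrow> 2 \<notin># y \<Longrightarrow> count y 1 + 2 \<le> count x 1"
proof -
  obtain ps qs where pq: "head_swap b (desc x) (desc y) = (ps, qs)" by fastforce
  have eq: "p = mset ps" "q = mset qs" using assms(1) pq by (auto simp: swap_def)
  note * = head_swap_basic[OF pq, of c] head_swap_counts[OF pq, of c]
  show "size p = size x" "size q = size y" "sum_mset p + sum_mset q = sum_mset x + sum_mset y"
    "set_mset p \<subseteq> {1..max b (c - 1)}" "set_mset q \<subseteq> {1..Suc b}"
    "Suc b < c \<Longrightarrow> count p (c - 1) = count y c"
    "count q 1 = count y 1"
    "2 \<in># q \<Longrightarrow> 2 \<notin># y \<Longrightarrow> count y 1 + 2 \<le> count x 1"
    using * assms(2-4) by (simp_all add: eq sum_mset_sum_list count_mset)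
qed

definition unswap :: "nat \<Rightarrow> nat multiset \<times> nat multiset \<Rightarrow> nat multiset \<times> nat multiset" where
  "unswap b = (\<lambda>(x, y). map_prod mset mset (head_unswap b (desc x) (desc y)))"

lemma unswap_swap:
  assumes "swap b (x, y) = (p, q)" "size x = Suc (size y)"
    and "set_mset x \<subseteq> {1..b}" "set_mset y \<subseteq> {1..c}"
  shows "unswap b (p, q) = (x, y)"
proof -
  obtain ps qs where pq: "head_swap b (desc x) (desc y) = (ps, qs)" by fastforce
  have "sorted_wrt (\<ge>) ps \<and> sorted_wrt (\<ge>) qs \<and> head_unswap b ps qs = (desc x, desc y)"
    by (rule head_swap_inverse[OF pq]) (use assms in auto)
  moreover have "p = mset ps" "q = mset qs" using assms(1) pq by (auto simp: swap_def)
  ultimately show ?thesis by (simp add: unswap_def desc_mset)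
qed

section \<open>Triples with one more column than rows\<close>

text \<open>Each injection below is given by a choice of \<open>t\<close> for every \<open>s\<close>
  and a map \<open>g\<close> decoding \<open>s\<close> from \<open>t\<close>; injectivity is then
  automatic.\<close>

lemma lepoll_by_inverse:
  assumes "\<And>s. s \<in> S \<Longrightarrow> \<exists>t\<in>T. g t = s"
  shows "S \<lesssim> T"
proof -
  have "S \<subseteq> g ` T" using assms by fastforce
  then show ?thesis by (meson image_lepoll lepoll_trans subset_imp_lepoll)
qed

text \<open>With \<open>k = K - 2\<close> and \<open>m = K - 1\<close>, these are the triples with a rectangle of \<open>K\<close> rows and \<open>K + a\<close>
  columns that are left over by the decrement-increment map. In \<open>rect_tgt\<close>, \<open>x\<close> and \<open>y\<close> have
  changed roles, and a further column of height \<open>K\<close> is counted.\<close>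

definition rect_src :: "nat \<Rightarrow> nat \<Rightarrow> (nat \<times> nat multiset \<times> nat multiset) set" where
  "rect_src a n = {(k, x, y). set_mset x \<subseteq> {1..k} \<and> set_mset y \<subseteq> {1..k + a + 2} \<and>
     size x = Suc (size y) \<and> (k + 2) * (k + a + 2) + sum_mset x + sum_mset y = n}"

definition rect_tgt :: "nat \<Rightarrow> nat \<Rightarrow> (nat \<times> nat multiset \<times> nat multiset) set" where
  "rect_tgt a n = {(m, x, y). set_mset x \<subseteq> {1..m + a} \<and> set_mset y \<subseteq> {1..m + 1} \<and>
     size x = Suc (size y) \<and> (m + 1) * (m + a + 2) + sum_mset x + sum_mset y = n}"

lemma rect_src_D:
  assumes "(k, x, y) \<in> rect_src a n"
  shows "set_mset x \<subseteq> {1..k}" "set_mset y \<subseteq> {1..k + a + 2}" "size x = Suc (size y)"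
    "(k + 2) * (k + a + 2) + sum_mset x + sum_mset y = n" "1 \<le> k"
proof -
  show *: "set_mset x \<subseteq> {1..k}" "set_mset y \<subseteq> {1..k + a + 2}" "size x = Suc (size y)"
    "(k + 2) * (k + a + 2) + sum_mset x + sum_mset y = n"
    using assms by (auto simp: rect_src_def)
  have "x \<noteq> {#}" using *(3) by auto
  then obtain z where "z \<in># x" by (auto dest: multiset_nonemptyE)
  then show "1 \<le> k" using *(1) by fastforce
qed

text \<open>If the exchange puts a part \<open>k + a + 1\<close> into \<open>p\<close>, the
  rectangle term grows by \<open>k + 2\<close> and this part drops to \<open>a - 1\<close>, positive
  as \<open>a \<ge> 2\<close>. Otherwise the term shrinks by \<open>k + a + 2\<close>, replaced by
  new parts \<open>a + 1\<close> and \<open>k + 1\<close>. A part \<open>m + 1\<close> in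
  \<open>y\<close> tells the two cases apart.\<close>

lemma rect_src_lepoll_large:
  assumes "a \<ge> 2"
  shows "rect_src a n \<lesssim> rect_tgt a n"
proof (rule lepoll_by_inverse)
  define g where "g = (\<lambda>(m, x, y). if m + 1 \<in># y
      then (m, unswap m (x - {#a + 1#}, y - {#m + 1#}))
      else (m - 1, unswap (m - 1) (add_mset (m + a) (x - {#a - 1#}), y)))"
  fix s assume s: "s \<in> rect_src a n"
  obtain k x y where sk: "s = (k, x, y)" by (cases s)
  note D = rect_src_D[OF s[unfolded sk]]
  obtain p q where pq: "swap k (x, y) = (p, q)" by fastforce
  note P = swap_props[OF pq D(3,1,2)] and U = unswap_swap[OF pq D(3,1,2)]
  have pr: "set_mset p \<subseteq> {1..k + a + 1}" using P(4) by auto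
  show "\<exists>t\<in>rect_tgt a n. g t = s"
  proof (cases "k + a + 1 \<in># p")
    case True
    then obtain p' where p: "p = add_mset (k + a + 1) p'" by (metis insert_DiffM)
    have "(k + 1, add_mset (a - 1) p', q) \<in> rect_tgt a n"
      using pr P(1-3,5) D assms unfolding p rect_tgt_def by (auto simp: algebra_simps)
    moreover have "k + 2 \<notin># q" using P(5) by fastforce
    then have "g (k + 1, add_mset (a - 1) p', q) = s"
      using U by (simp add: g_def sk p)
    ultimately show ?thesis by blast
  next
    case False
    then have "set_mset p \<subseteq> {1..k + a}" using pr by (metis Suc_eq_plus1 atLeastAtMostSuc_conv le_add2 subset_insert)
    then have "(k, add_mset (a + 1) p, add_mset (k + 1) q) \<in> rect_tgt a n"
      using P(1-3,5) D assms unfolding rect_tgt_def by (auto simp: algebra_simps)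
    moreover have "g (k, add_mset (a + 1) p, add_mset (k + 1) q) = s"
      using U by (simp add: g_def sk)
    ultimately show ?thesis by blast
  qed
qed

lemma mset_split_replicate:
  "r \<le> count x a \<Longrightarrow> \<exists>x'. x = replicate_mset r a + x'"
  by (metis count_le_replicate_mset_subset_eq mset_subset_eq_exists_conv)

lemma interval_shrink: "A \<subseteq> {1..Suc c} \<Longrightarrow> Suc c \<notin> A \<Longrightarrow> A \<subseteq> {1..c}"
  by (auto simp: subset_iff le_Suc_eq)

text \<open>For \<open>a = 1\<close>, a single part \<open>k + 3\<close> of \<open>y\<close> becomes a \<open>1\<close>; the exchange of \<open>2 \<in> x\<close>
  with \<open>k + 2 \<in> y\<close>, as often as possible, keeps the image away from that of the other cases.\<close>

lemma rect_src_lepoll_1: "rect_src 1 n \<lesssim> rect_tgt 1 n"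
proof (rule lepoll_by_inverse)
  define split where "split m x y = (m - 1, unswap (m - 1) (add_mset (m + 1) (add_mset (m + 1) (x - {#1#} - {#m#})), y))"
    for m :: nat and x y :: "nat multiset"
  define trade where "trade m x y = (let r = count x (m + 1) in
        (m - 1, x - replicate_mset r (m + 1) + replicate_mset r 2,
          add_mset (m + 2) (y - {#1#} - replicate_mset r 2 + replicate_mset r (m + 1))))"
    for m :: nat and x y :: "nat multiset"
  \<comment> \<open>The branches undo the three cases below. Only the first has
    \<open>m = k\<close>; for \<open>m = k + 1\<close>, the part \<open>m\<close> occurs in
    \<open>x\<close> after splitting but not after trading.\<close>
  define g where "g = (\<lambda>(m, x, y).
      if 2 \<in># x \<and> m + 1 \<in># y then (m, unswap m (x - {#2#}, y - {#m + 1#}))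
      else if m \<in># x \<and> m + 1 \<notin># y then split m x y
      else trade m x y)"
  have g_pair: "g (m, add_mset 2 x, add_mset (m + 1) y) = (m, unswap m (x, y))" for m x y
    by (simp add: g_def)
  have g_split: "g (m, {#1, m#} + x, y) = (m - 1, unswap (m - 1) ({#m + 1, m + 1#} + x, y))"
    if "m + 1 \<notin># y" for m x y
  proof -
    have "g (m, {#1, m#} + x, y) = split m ({#1, m#} + x) y"
      using that by (simp add: g_def)
    then show ?thesis by (simp add: split_def)
  qed
  have g_trade: "g (m, replicate_mset r (m + 1) + x, add_mset 1 (replicate_mset r 2 + y))
      = (m - 1, replicate_mset r 2 + x, add_mset (m + 2) (replicate_mset r (m + 1) + y))"
    if "m \<notin># x" "m + 1 \<notin># x" "2 \<notin># x \<or> m + 1 \<notin># y" "m \<ge> 2" for m r x y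
  proof -
    let ?x = "replicate_mset r (m + 1) + x" and ?y = "add_mset 1 (replicate_mset r 2 + y)"
    have "\<not> (2 \<in># ?x \<and> m + 1 \<in># ?y)" "m \<notin># ?x"
      using that by (auto simp: in_replicate_mset)
    then have "g (m, ?x, ?y) = trade m ?x ?y" by (simp only: g_def prod.case if_False simp_thms)
    moreover have "count ?x (m + 1) = r" using that(2) by (simp add: not_in_iff)
    ultimately show ?thesis unfolding trade_def by (simp add: ac_simps)
  qed
  fix s assume s: "s \<in> rect_src 1 n"
  obtain k x y where sk: "s = (k, x, y)" by (cases s)
  note D = rect_src_D[OF s[unfolded sk]]
  obtain p q where pq: "swap k (x, y) = (p, q)" by fastforce
  note P = swap_props[OF pq D(3,1,2)] and U = unswap_swap[OF pq D(3,1,2)]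
  have pr: "set_mset p \<subseteq> {1..k + 2}" using P(4) by auto
  have cnt: "count p (k + 2) = count y (k + 3)" using P(6) by (simp add: numeral_eq_Suc)
  show "\<exists>t\<in>rect_tgt 1 n. g t = s"
  \<comment> \<open>A single part \<open>k + 2\<close> of \<open>p\<close> cannot drop to
    \<open>a - 1 = 0\<close>; by \<open>cnt\<close> this case arises exactly when \<open>y\<close>
    has one part \<open>k + 3\<close>.\<close>
  proof (cases "count y (k + 3) = 1")
    case True
    then obtain y1 where y: "y = add_mset (k + 3) y1"
      by (metis count_inI insert_DiffM zero_neq_one)
    have "k + 3 \<notin># y1" using True by (simp add: y not_in_iff)
    then have y1: "set_mset y1 \<subseteq> {1..k + 2}"
      using interval_shrink[of "set_mset y1" "k + 2"] D(2) unfolding y by (simp add: numeral_eq_Suc)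
    define r where "r = min (count x 2) (count y1 (k + 2))"
    obtain x' where x: "x = replicate_mset r 2 + x'"
      using mset_split_replicate[of r x 2] by (auto simp: r_def)
    obtain y' where y': "y1 = replicate_mset r (k + 2) + y'"
      using mset_split_replicate[of r y1 "k + 2"] by (auto simp: r_def)
    define t where "t = (k + 1, replicate_mset r (k + 2) + x',
        add_mset 1 (replicate_mset r 2 + y'))"
    have "count x' 2 = 0 \<or> count y' (k + 2) = 0"
      using arg_cong[OF x, of "\<lambda>z. count z 2"] arg_cong[OF y', of "\<lambda>z. count z (k + 2)"] r_def
      by (simp; linarith)
    then have disj: "2 \<notin># x' \<or> k + 2 \<notin># y'" by (meson not_in_iff)
    have x': "set_mset x' \<subseteq> {1..k}" "k + 2 \<notin># x'" "k + 1 \<notin># x'"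
      using D(1) unfolding x by auto
    have "t \<in> rect_tgt 1 n"
      using D x' y1 unfolding t_def rect_tgt_def x y y'
      by (auto simp: algebra_simps in_replicate_mset)
    moreover have "g t = s"
      using disj x' D(5) g_trade[of "k + 1" x' y' r] by (simp add: t_def sk x y y')
    ultimately show ?thesis by blast
  next
    case no: False
    show ?thesis
    proof (cases "k + 2 \<in># p")
      case True
      then have "count p (k + 2) \<ge> 2" using no cnt
        by (metis One_nat_def Suc_1 Suc_leI count_greater_zero_iff le_neq_implies_less)
      then obtain p' where "p = replicate_mset 2 (k + 2) + p'" by (metis mset_split_replicate)
      then have p: "p = {#k + 2, k + 2#} + p'" by (simp add: numeral_2_eq_2)
      \<comment> \<open>Two parts \<open>k + 2\<close> become \<open>1\<close> and
        \<open>k + 1\<close>; the loss \<open>k + 2\<close> is the growth of the rectangle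
        term.\<close>
      define t where "t = (k + 1, {#1, k + 1#} + p', q)"
      have nq: "k + 2 \<notin># q" using P(5) by fastforce
      have "t \<in> rect_tgt 1 n"
        using pr P(1-3,5) D unfolding p rect_tgt_def t_def by (auto simp: algebra_simps)
      moreover have "g t = s"
        using U nq g_split[of "k + 1" q p'] by (simp add: sk p t_def)
      ultimately show ?thesis by blast
    next
      case False
      then have "set_mset p \<subseteq> {1..k + 1}" using pr
        by (metis Suc_eq_plus1 add_2_eq_Suc' atLeastAtMostSuc_conv le_add2 subset_insert)
      then have "(k, add_mset 2 p, add_mset (k + 1) q) \<in> rect_tgt 1 n"
        using P(1-3,5) D unfolding rect_tgt_def by (auto simp: algebra_simps)
      moreover have "g (k, add_mset 2 p, add_mset (k + 1) q) = s"
        using U by (simp only: g_pair sk)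
      ultimately show ?thesis by blast
    qed
  qed
qed

text \<open>For \<open>a = 0\<close>, no exchange is needed to get the ranges right; it only serves when \<open>y\<close> has at least
  two parts \<open>k + 2\<close>, no part \<open>2\<close>, and too many ones for \<open>merge\<close>.\<close>

lemma rect_src_lepoll_0: "rect_src 0 n \<lesssim> rect_tgt 0 n"
proof (rule lepoll_by_inverse)
  define pair where "pair m x y = (m, x - {#m#}, y - {#2#})" for m :: nat and x y :: "nat multiset"
  define three where "three m x y = (m, x - {#m#}, add_mset (m + 2) (y - {#m + 1#} - {#3#}))"
    for m :: nat and x y :: "nat multiset"
  define few where "few x y = (let i = (count x 2 + 1) div 2; e = count y 1 + 1 - i in
      (1::nat, replicate_mset (i + e + 1) (1::nat), replicate_mset i (3::nat) + replicate_mset e 1))"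
    for x y :: "nat multiset"
  define many where "many x y = (let i = (count y 1 + 4) div 2; e = (count x 2 - 1) div 2 in
      (1::nat, replicate_mset (i + e + 1) (1::nat), replicate_mset i (3::nat) + replicate_mset e 1))"
    for x y :: "nat multiset"
  define undo where "undo m x y = (m - 1, unswap (m - 1) (add_mset m x, add_mset 1 y))"
    for m :: nat and x y :: "nat multiset"
  define ones where "ones m x y = (m - 1, x, add_mset 2 (add_mset (m + 1) (y - {#1#} - {#1#})))"
    for m :: nat and x y :: "nat multiset"
  \<comment> \<open>For \<open>m = 3\<close> the part \<open>m - 1\<close> added by the encoding is
    itself a \<open>2\<close>, so one more \<open>2\<close> is discounted in recovering
    \<open>h\<close>.\<close>
  define merge where "merge m x y = (let h = count y 2 - 1 - (if m = 3 then 1 else 0) in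
        (m - 1, x - replicate_mset h 2 + replicate_mset (2 * h) 1,
          add_mset (m + 1) (add_mset (m + 1)
            (y - {#m - 1#} - replicate_mset (h + 1) 2 + replicate_mset (2 * h) 1))))"
    for m :: nat and x y :: "nat multiset"
  \<comment> \<open>The tests separate the images of all cases. For \<open>m = 2\<close>, the number
    of threes in \<open>y\<close> is \<open>0\<close> for \<open>few\<close>, \<open>1\<close> for
    \<open>many\<close> and at least \<open>2\<close> for \<open>three\<close>.\<close>
  define g where "g = (\<lambda>(m, x, y).
      if m \<in># x then
        if 2 \<in># y then pair m x y
        else if m = 2 \<and> count y 3 = 0 then few x y
        else if m = 2 \<and> count y 3 = 1 then many x y
        else if m + 1 \<in># y then three m x y
        else undo m x y
      else if count y 1 \<ge> 2 then ones m x y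
      else merge m x y)"
  have g_pair: "g (m, add_mset m x, add_mset 2 y) = (m, x, y)" for m x y
    by (simp add: g_def pair_def)
  have g_ones: "g (m, x, {#1, 1#} + y) = (m - 1, x, {#2, m + 1#} + y)" if "m \<notin># x" for m x y
    using that by (simp add: g_def ones_def)
  have g_three: "g (m, add_mset m x, {#m + 1, 3#} + y) = (m, x, add_mset (m + 2) y)"
    if "2 \<notin># y" "m \<ge> 2" for m x y
    using that by (simp add: g_def three_def)
  have g_undo: "g (m, add_mset m x, y) = (m - 1, unswap (m - 1) (add_mset m (add_mset m x), add_mset 1 y))"
    if "2 \<notin># y" "m + 1 \<notin># y" "m \<ge> 3" for m x y
    using that by (simp add: g_def undo_def)
  have g_merge: "g (m, replicate_mset h 2 + x, add_mset (m - 1) (replicate_mset (h + 1) 2 + y))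
      = (m - 1, replicate_mset (2 * h) 1 + x, replicate_mset (2 * h) 1 + {#m + 1, m + 1#} + y)"
    if "m \<notin># x" "m \<ge> 3" "count y 1 \<le> 1" "2 \<notin># y" for m h x y
  proof -
    let ?y = "add_mset (m - 1) (replicate_mset (h + 1) 2 + y)"
    have 1: "m \<notin># replicate_mset h 2 + x" using that by (auto simp: in_replicate_mset)
    have 2: "\<not> count ?y 1 \<ge> 2" using that by auto
    have "count y 2 = 0" using that by (meson not_in_iff)
    then have 3: "count ?y 2 - 1 - (if m = 3 then 1 else 0) = h"
      using that(2) by auto
    have "g (m, replicate_mset h 2 + x, ?y) = merge m (replicate_mset h 2 + x) ?y"
      using 1 2 by (simp only: g_def prod.case if_False)
    then show ?thesis unfolding merge_def 3 Let_def by (simp add: ac_simps)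
  qed
  have g_few: "g (2, replicate_mset (2 * j + 1) 2 + replicate_mset d 1, replicate_mset (2 * j + d) 1)
      = (1, replicate_mset (2 * j + d + 2) 1, replicate_mset (j + 1) 3 + replicate_mset (j + d) 1)" for j d
  proof -
    let ?x = "replicate_mset (2 * j + 1) 2 + replicate_mset d (1::nat)"
      and ?y = "replicate_mset (2 * j + d) (1::nat)"
    have "g (2, ?x, ?y) = few ?x ?y" by (simp add: g_def)
    moreover have "(count ?x 2 + 1) div 2 = j + 1" "count ?y 1 + 1 - (j + 1) = j + d"
      "j + 1 + (j + d) + 1 = 2 * j + d + 2" by simp_all
    ultimately show ?thesis unfolding few_def Let_def by (simp only:)
  qed
  have g_many: "g (2, replicate_mset (2 * e + 1) 2 + replicate_mset (2 * d + 1) 1, add_mset 3 (replicate_mset (2 * e + 2 * d) 1))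
      = (1, replicate_mset (2 * e + d + 3) 1, replicate_mset (e + d + 2) 3 + replicate_mset e 1)" for e d
  proof -
    let ?x = "replicate_mset (2 * e + 1) 2 + replicate_mset (2 * d + 1) (1::nat)"
      and ?y = "add_mset 3 (replicate_mset (2 * e + 2 * d) (1::nat))"
    have "g (2, ?x, ?y) = many ?x ?y" by (simp add: g_def)
    moreover have "(count ?y 1 + 4) div 2 = e + d + 2" "(count ?x 2 - 1) div 2 = e"
      "e + d + 2 + e + 1 = 2 * e + d + 3" by simp_all
    ultimately show ?thesis unfolding many_def Let_def by (simp only:)
  qed
  fix s assume s: "s \<in> rect_src 0 n"
  obtain k x y where sk: "s = (k, x, y)" by (cases s)
  note D = rect_src_D[OF s[unfolded sk]]
  obtain p q where pq: "swap k (x, y) = (p, q)" by fastforce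
  note P = swap_props[OF pq D(3,1,2)] and U = unswap_swap[OF pq D(3,1,2)]
  have cnt: "count p (k + 1) = count y (k + 2)" using P(6) by simp
  define i where "i = count y (k + 2)"
  define e where "e = count y 1"
  show "\<exists>t\<in>rect_tgt 0 n. g t = s"
  proof (cases "i = 0")
    case True
    then have "k + 2 \<notin># y" by (simp add: i_def not_in_iff)
    then have yr: "set_mset y \<subseteq> {1..k + 1}" using D(2)
      by (metis Suc_eq_plus1 add_0_right add_2_eq_Suc' atLeastAtMostSuc_conv le_add2 subset_insert)
    have "(k, add_mset k x, add_mset 2 y) \<in> rect_tgt 0 n"
      using D yr by (auto simp: rect_tgt_def algebra_simps)
    moreover have "g (k, add_mset k x, add_mset 2 y) = s"
      by (simp only: g_pair sk)
    ultimately show ?thesis by blast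
  next
    case i: False
    have "k + 2 \<in># y" using i by (metis i_def not_in_iff)
    then obtain y1 where y1: "y = add_mset (k + 2) y1" by (metis insert_DiffM)
    have xk: "k + 1 \<notin># x" using D(1) by auto
    show ?thesis
    proof (cases "2 \<in># y")
      case True
      then have "2 \<in># y1" using D(5) y1 by auto
      then obtain y2 where y2: "y1 = add_mset 2 y2" by (metis insert_DiffM)
      \<comment> \<open>Turning \<open>k + 2\<close> and \<open>2\<close> into two ones loses
        \<open>k + 2\<close>, the growth of the rectangle term.\<close>
      define t where "t = (k + 1, x, {#1, 1#} + y2)"
      have "t \<in> rect_tgt 0 n"
        using D unfolding t_def rect_tgt_def y1 y2 by (auto simp: algebra_simps)
      moreover have "g t = s" unfolding t_def g_ones[OF xk] sk y1 y2 by simp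
      ultimately show ?thesis by blast
    next
      case no2: False
      show ?thesis
      proof (cases "k = 1")
        \<comment> \<open>Here \<open>x\<close> has only ones and \<open>y\<close> only ones and
          threes, so \<open>i\<close> and \<open>e\<close> determine the triple and its image is a
          formula in them.\<close>
        case k1: True
        have x: "x = replicate_mset (size x) 1"
          by (rule set_mset_subset_singletonD) (use D(1) k1 in auto)
        have y: "y = replicate_mset i 3 + replicate_mset e 1"
        proof (rule multiset_eqI)
          fix z
          have "z \<in># y \<Longrightarrow> z = 1 \<or> z = 2 \<or> z = 3" using D(2) k1 by fastforce
          then show "count y z = count (replicate_mset i 3 + replicate_mset e 1) z"
            using no2 k1
            by (cases "z \<in># y") (auto simp: i_def e_def not_in_iff numeral_eq_Suc)
        qed
        have "size y = i + e" unfolding y by simp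
        with x D(3) have x: "x = replicate_mset (i + e + 1) 1" by simp
        have n: "n = 10 + 4 * i + 2 * e" using D(4) k1 unfolding x y by simp
        show ?thesis
        proof (cases "i \<le> e + 1")
          case True
          define j d where "j = i - 1" and "d = e - j"
          have je: "i = Suc j" "e = j + d" using True \<open>i \<noteq> 0\<close> by (auto simp: j_def d_def)
          define t where "t = (2::nat, replicate_mset (2 * j + 1) (2::nat) + replicate_mset d 1,
              replicate_mset (2 * j + d) (1::nat))"
          have "t \<in> rect_tgt 0 n"
            unfolding t_def rect_tgt_def n je by (auto simp: in_replicate_mset)
          moreover have "2 * j + d + 2 = i + e + 1" "j + 1 = i" "j + d = e" using je by simp_all
          then have "g t = s" unfolding t_def g_few sk x y k1 by (simp only:)
          ultimately show ?thesis by blast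
        next
          case False
          define d where "d = i - e - 2"
          have i': "i = e + 2 + d" using False by (simp add: d_def)
          define t where "t = (2::nat, replicate_mset (2 * e + 1) (2::nat) + replicate_mset (2 * d + 1) 1,
              add_mset 3 (replicate_mset (2 * e + 2 * d) (1::nat)))"
          have "t \<in> rect_tgt 0 n"
            unfolding t_def rect_tgt_def n i' by (auto simp: in_replicate_mset)
          moreover have "2 * e + d + 3 = i + e + 1" "e + d + 2 = i" using i' by simp_all
          then have "g t = s" unfolding t_def g_many sk x y k1 by (simp only:)
          ultimately show ?thesis by blast
        qed
      next
        case False
        then have k2: "k \<ge> 2" using D(5) by simp
        show ?thesis
        proof (cases "i = 1")
          case True
          then have "k + 2 \<notin># y1" by (simp add: i_def y1 not_in_iff)
          then have yr: "set_mset y1 \<subseteq> {1..k + 1}"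
            using interval_shrink[of "set_mset y1" "k + 1"] D(2) unfolding y1 by simp
          define t where "t = (k, add_mset k x, {#k + 1, 3#} + y1)"
          have "t \<in> rect_tgt 0 n"
            using D yr k2 unfolding t_def rect_tgt_def y1 by (auto simp: algebra_simps)
          moreover have "g t = s" using g_three[of y1 k x] no2 k2 by (simp add: t_def sk y1)
          ultimately show ?thesis by blast
        next
          case False
          with i have i2: "i \<ge> 2" by simp
          then obtain y2 where "y = replicate_mset 2 (k + 2) + y2"
            by (metis mset_split_replicate i_def)
          then have y2: "y = {#k + 2, k + 2#} + y2" by (simp add: numeral_2_eq_2)
          show ?thesis
          proof (cases "e \<ge> 2 \<and> 2 \<notin># q")
            case True
            have "2 \<le> count p (k + 1)" using cnt i2 i_def by simp
            then obtain p' where "p = replicate_mset 2 (k + 1) + p'"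
              by (metis mset_split_replicate)
            then have p: "p = {#k + 1, k + 1#} + p'" by (simp add: numeral_2_eq_2)
            have "1 \<in># q" using P(7) True by (metis e_def not_in_iff not_numeral_le_zero)
            then obtain q' where q: "q = add_mset 1 q'" by (metis insert_DiffM)
            have nq: "k + 2 \<notin># q" using P(5) by fastforce
            \<comment> \<open>Dropping a \<open>k + 1\<close> from \<open>p\<close> and a
              \<open>1\<close> from \<open>q\<close> pays for the larger rectangle; the second part
              \<open>k + 1\<close> stays as the mark tested by \<open>g\<close>.\<close>
            define t where "t = (k + 1, add_mset (k + 1) p', q')"
            have "t \<in> rect_tgt 0 n"
              using P D k2 unfolding t_def rect_tgt_def p q by (auto simp: algebra_simps)
            moreover have "g t = s"
              using U True nq k2 g_undo[of q' "k + 1" p'] by (simp add: t_def sk p q)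
            ultimately show ?thesis by blast
          next
            case False
            \<comment> \<open>In \<open>x\<close> and in \<open>y\<close>, \<open>h\<close> pairs of
              ones are merged into twos, leaving at most one \<open>1\<close> in \<open>y\<close>.
              If \<open>e \<ge> 2\<close>, then \<open>2 \<in># q\<close>, and that new
              \<open>2\<close> certifies that \<open>x\<close> has enough ones.\<close>
            define h where "h = e div 2"
            have "2 * h \<le> e" "e - 2 * h \<le> 1" by (auto simp: h_def)
            have "2 * h \<le> count x 1"
            proof (cases "e \<ge> 2")
              case True
              with False no2 P(8) show ?thesis using \<open>2 * h \<le> e\<close> by (simp add: e_def)
            qed (simp add: h_def)
            then obtain x' where x: "x = replicate_mset (2 * h) 1 + x'"
              by (metis mset_split_replicate)
            have "count y2 1 = e" by (simp add: e_def y2)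
            then obtain y3 where y3: "y2 = replicate_mset (2 * h) 1 + y3"
              using mset_split_replicate[of "2 * h" y2 1] \<open>2 * h \<le> e\<close> by auto
            have c1: "count y3 1 \<le> 1" using \<open>count y2 1 = e\<close> \<open>e - 2 * h \<le> 1\<close> y3 by simp
            have c2: "count y3 2 = 0" using no2 by (simp add: y2 y3 not_in_iff)
            define t where "t = (k + 1, replicate_mset h 2 + x', add_mset k (replicate_mset (h + 1) 2 + y3))"
            have xk': "k + 1 \<notin># x'" using xk x by auto
            have "t \<in> rect_tgt 0 n"
              using D k2 unfolding t_def rect_tgt_def x y2 y3
              by (auto simp: algebra_simps in_replicate_mset)
            moreover have "g t = s"
              using xk' c1 c2 k2 g_merge[of "k + 1" x' y3 h]
              by (simp add: t_def sk x y2 y3 not_in_iff)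
            ultimately show ?thesis by blast
          qed
        qed
      qed
    qed
  qed
qed

section \<open>Decrementing columns and incrementing rows\<close>

text \<open>For \<open>size y \<le> s\<close>, puts a column of height \<open>s\<close> in front of
  the diagram; \<open>dn\<close> removes the first column.\<close>

definition up :: "nat \<Rightarrow> nat multiset \<Rightarrow> nat multiset" where
  "up s y = image_mset Suc y + replicate_mset (s - size y) 1"

definition dn :: "nat multiset \<Rightarrow> nat multiset" where
  "dn x = filter_mset (\<lambda>p. 0 < p) (image_mset (\<lambda>p. p - 1) x)"

lemma dn_add [simp]: "dn (add_mset p x) = (if p \<le> 1 then dn x else add_mset (p - 1) (dn x))"
  by (auto simp: dn_def)

lemma dn_empty [simp]: "dn {#} = {#}"
  by (simp add: dn_def)

lemma in_dn_iff: "p \<in># dn x \<longleftrightarrow> 0 < p \<and> Suc p \<in># x"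
  by (induction x) auto

lemma size_dn_le: "size (dn x) \<le> size x"
  by (induction x) auto

lemma size_dn_less: "1 \<in># x \<Longrightarrow> size (dn x) < size x"
  by (induction x) (auto simp: less_Suc_eq_le size_dn_le)

lemma size_dn_eq: "\<forall>p\<in>#x. 2 \<le> p \<Longrightarrow> size (dn x) = size x"
  by (induction x) auto

lemma sum_dn: "\<forall>p\<in>#x. 1 \<le> p \<Longrightarrow> sum_mset (dn x) + size x = sum_mset x"
  by (induction x) (auto simp: le_Suc_eq)

lemma size_up: "size y \<le> s \<Longrightarrow> size (up s y) = s"
  by (simp add: up_def)

lemma sum_image_Suc: "sum_mset (image_mset Suc y) = sum_mset y + size y"
  by (induction y) auto

lemma sum_up: "size y \<le> s \<Longrightarrow> sum_mset (up s y) = sum_mset y + s"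
  by (simp add: up_def sum_image_Suc)

lemma set_up: "size y \<le> s \<Longrightarrow> set_mset y \<subseteq> {1..c} \<Longrightarrow> set_mset (up s y) \<subseteq> {1..Suc c}"
  by (auto simp: up_def in_replicate_mset)

lemma one_in_up: "size y < s \<Longrightarrow> 1 \<in># up s y"
  by (simp add: up_def in_replicate_mset)

lemma dn_image_Suc: "\<forall>p\<in>#y. 1 \<le> p \<Longrightarrow> dn (image_mset Suc y) = y"
  by (induction y) auto

lemma dn_up: "\<forall>p\<in>#y. 1 \<le> p \<Longrightarrow> dn (up s y) = y"
proof -
  have "dn (z + replicate_mset k 1) = dn z" for z k
    by (simp add: dn_def filter_mset_eq_conv)
  then show "\<forall>p\<in>#y. 1 \<le> p \<Longrightarrow> dn (up s y) = y"
    by (simp add: up_def dn_image_Suc)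
qed

lemma up_dn: "\<forall>p\<in>#x. 1 \<le> p \<Longrightarrow> up (size x) (dn x) = x"
  by (induction x) (auto simp: up_def Suc_diff_le size_dn_le le_Suc_eq)

lemma set_dn: "set_mset x \<subseteq> {1..Suc c} \<Longrightarrow> set_mset (dn x) \<subseteq> {1..c}"
  by (auto simp: in_dn_iff subset_iff)

text \<open>The triples that the first inequality has to move, with \<open>k + 1\<close> rows in the
  rectangle; \<open>durf_below\<close> holds the places available for them.\<close>

definition durf_above :: "nat \<Rightarrow> nat \<Rightarrow> (nat \<times> nat multiset \<times> nat multiset) set" where
  "durf_above a n = {(k, x, y). set_mset x \<subseteq> {1..k + 1} \<and> k + 1 \<in># x \<and> set_mset y \<subseteq> {1..k + a + 1}
     \<and> size y < size x \<and> (k + 1) * (k + a + 1) + sum_mset x + sum_mset y = n}"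

definition durf_below :: "nat \<Rightarrow> nat \<Rightarrow> (nat \<times> nat multiset \<times> nat multiset) set" where
  "durf_below a n = {(k, x, y). set_mset x \<subseteq> {1..k} \<and> set_mset y \<subseteq> {1..k + a + 1}
     \<and> size x \<le> size y \<and> (k + 1) * (k + a + 1) + sum_mset x + sum_mset y = n}"

text \<open>As no row of \<open>y\<close> has full width, a new first column of height
  \<open>|x|\<close> fits and absorbs the cells taken from \<open>x\<close>. The full column leaves
  a part \<open>k\<close>, the added rows a part \<open>1\<close>.\<close>

lemma durf_above_lepoll_1:
  "{(k, x, y) \<in> durf_above a n. k + a + 1 \<notin># y}
    \<lesssim> {(k, x, y) \<in> durf_below a n. (k \<in># x \<or> k = 0) \<and> 1 \<in># y}"
proof (rule lepoll_by_inverse)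
  define g where "g = (\<lambda>(k::nat, x, y). (k, up (size y) x, dn y))"
  fix s assume "s \<in> {(k, x, y) \<in> durf_above a n. k + a + 1 \<notin># y}"
  then obtain k x y where s: "s = (k, x, y)" and x: "set_mset x \<subseteq> {1..k + 1}" "k + 1 \<in># x"
    and y: "set_mset y \<subseteq> {1..k + a + 1}" "k + a + 1 \<notin># y" and size: "size y < size x"
    and n: "(k + 1) * (k + a + 1) + sum_mset x + sum_mset y = n"
    by (auto simp: durf_above_def)
  have y': "set_mset y \<subseteq> {1..k + a}" using y by (auto simp: subset_iff le_Suc_eq)
  have pos: "\<forall>p\<in>#x. 1 \<le> p" "\<forall>p\<in>#y. 1 \<le> p" using x y by auto
  define t where "t = (k, dn x, up (size x) y)"
  have "k \<in># dn x \<or> k = 0" using x by (auto simp: in_dn_iff)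
  then have "t \<in> {(k, x, y) \<in> durf_below a n. (k \<in># x \<or> k = 0) \<and> 1 \<in># y}"
    using set_dn[of x k] x(1) set_up[OF _ y', of "size x"] size size_dn_le[of x] n sum_dn[OF pos(1)]
      one_in_up[OF size]
    by (simp add: t_def durf_below_def size_up sum_up)
  moreover have "g t = s" using size pos by (simp add: t_def g_def s size_up up_dn dn_up)
  ultimately show "\<exists>t\<in>{(k, x, y) \<in> durf_below a n. (k \<in># x \<or> k = 0) \<and> 1 \<in># y}. g t = s" by blast
qed

text \<open>A full column and a full row are absorbed by a rectangle larger by one in both
  directions, which needs one cell more; so the new first column of \<open>y\<close> is one shorter.
  A column of height \<open>1\<close> vanishes under \<open>dn\<close>, which gives
  \<open>|x| \<le> |y|\<close>.\<close>

lemma durf_above_lepoll_2: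
  "{(k, x, y) \<in> durf_above a n. k + a + 1 \<in># y \<and> 1 \<in># x - {#k + 1#}}
    \<lesssim> {(k, x, y) \<in> durf_below a n. \<not> (k \<in># x \<or> k = 0)}"
proof (rule lepoll_by_inverse)
  define g where "g = (\<lambda>(m, x, y). (m - 1, add_mset m (up (size y + 1) x), add_mset (m + a) (dn y)))"
  fix s assume "s \<in> {(k, x, y) \<in> durf_above a n. k + a + 1 \<in># y \<and> 1 \<in># x - {#k + 1#}}"
  then obtain k x y where s: "s = (k, x, y)" and x: "set_mset x \<subseteq> {1..k + 1}" "k + 1 \<in># x"
    and y: "set_mset y \<subseteq> {1..k + a + 1}" "k + a + 1 \<in># y" and size: "size y < size x"
    and n: "(k + 1) * (k + a + 1) + sum_mset x + sum_mset y = n" and one: "1 \<in># x - {#k + 1#}"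
    by (auto simp: durf_above_def)
  obtain x0 y0 where x0: "x = add_mset (k + 1) x0" and y0: "y = add_mset (k + a + 1) y0"
    using x y by (metis insert_DiffM)
  have one: "1 \<in># x0" using one x0 by simp
  have pos: "\<forall>p\<in>#x0. 1 \<le> p" "\<forall>p\<in>#y0. 1 \<le> p" using x y unfolding x0 y0 by auto
  have r: "set_mset x0 \<subseteq> {1..Suc k}" "set_mset y0 \<subseteq> {1..k + a + 1}" using x y unfolding x0 y0 by auto
  have sz: "size y0 \<le> size x0 - 1" "size x0 - 1 + 1 = size x0" "size (dn x0) \<le> size x0 - 1"
    using size size_dn_less[OF one] by (auto simp: x0 y0)
  define t where "t = (k + 1, dn x0, up (size x0 - 1) y0)"
  have "t \<in> {(k, x, y) \<in> durf_below a n. \<not> (k \<in># x \<or> k = 0)}"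
    using set_dn[OF r(1)] set_up[OF sz(1) r(2)] sz n sum_dn[OF pos(1)]
    by (auto simp: t_def durf_below_def size_up sum_up x0 y0 algebra_simps)
  moreover have "g t = s" using sz pos by (simp add: t_def g_def s size_up up_dn dn_up x0 y0)
  ultimately show "\<exists>t\<in>{(k, x, y) \<in> durf_below a n. \<not> (k \<in># x \<or> k = 0)}. g t = s" by blast
qed

text \<open>The same move, but no column vanishes under \<open>dn\<close>, so the result has
  \<open>|x| = |y| + 1\<close>.\<close>

lemma durf_above_lepoll_3:
  "{(k, x, y) \<in> durf_above a n. k + a + 1 \<in># y \<and> 1 \<notin># x - {#k + 1#}} \<lesssim> rect_src a n"
proof (rule lepoll_by_inverse)
  define g where "g = (\<lambda>(k, x, y). (k, add_mset (k + 1) (image_mset Suc x), add_mset (k + a + 1) (dn y)))"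
  fix s assume "s \<in> {(k, x, y) \<in> durf_above a n. k + a + 1 \<in># y \<and> 1 \<notin># x - {#k + 1#}}"
  then obtain k x y where s: "s = (k, x, y)" and x: "set_mset x \<subseteq> {1..k + 1}" "k + 1 \<in># x"
    and y: "set_mset y \<subseteq> {1..k + a + 1}" "k + a + 1 \<in># y" and size: "size y < size x"
    and n: "(k + 1) * (k + a + 1) + sum_mset x + sum_mset y = n" and one: "1 \<notin># x - {#k + 1#}"
    by (auto simp: durf_above_def)
  obtain x0 y0 where x0: "x = add_mset (k + 1) x0" and y0: "y = add_mset (k + a + 1) y0"
    using x y by (metis insert_DiffM)
  have one: "1 \<notin># x0" using one x0 by simp
  have pos: "\<forall>p\<in>#x0. 1 \<le> p" "\<forall>p\<in>#y0. 1 \<le> p" using x y unfolding x0 y0 by auto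
  have two: "\<forall>p\<in>#x0. 2 \<le> p" using pos one by (metis One_nat_def Suc_1 Suc_leI le_neq_implies_less)
  have r: "set_mset x0 \<subseteq> {1..Suc k}" "set_mset y0 \<subseteq> {1..k + a + 1}" using x y unfolding x0 y0 by auto
  have dn0: "size (dn x0) = size x0" "image_mset Suc (dn x0) = x0"
    using size_dn_eq[OF two] up_dn[OF pos(1)] by (auto simp: up_def)
  show "\<exists>t\<in>rect_src a n. g t = s"
  proof (cases "size x0")
    case 0
    then show ?thesis using size by (simp add: x0 y0)
  next
    case (Suc m)
    have sz: "size y0 \<le> m" using size Suc by (auto simp: x0 y0)
    define t where "t = (k, dn x0, up m y0)"
    have "t \<in> rect_src a n"
      using set_dn[OF r(1)] set_up[OF sz(1) r(2)] sz n sum_dn[OF pos(1)] dn0 Suc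
      by (auto simp: t_def rect_src_def size_up sum_up x0 y0 algebra_simps)
    moreover have "g t = s" using sz pos dn0 by (simp add: t_def g_def s dn_up x0 y0)
    ultimately show ?thesis by blast
  qed
qed

text \<open>The rows arise by incrementing \<open>x\<close>, so none is \<open>1\<close>; the
  columns arise by decrementing \<open>y\<close> and the extra column \<open>m + 1\<close>, which
  leaves the part \<open>m\<close>.\<close>

lemma rect_tgt_lepoll:
  "rect_tgt a n \<lesssim> {(k, x, y) \<in> durf_below a n. (k \<in># x \<or> k = 0) \<and> 1 \<notin># y}"
proof (rule lepoll_by_inverse)
  define g where "g = (\<lambda>(m, x, y). (m, dn y, up (size y) x - {#m + 1#}))"
  fix s assume "s \<in> rect_tgt a n"
  then obtain m x y where s: "s = (m, x, y)" and x: "set_mset x \<subseteq> {1..m + a}"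
    and y: "set_mset y \<subseteq> {1..m + 1}" and size: "size x = Suc (size y)"
    and n: "(m + 1) * (m + a + 2) + sum_mset x + sum_mset y = n"
    by (auto simp: rect_tgt_def)
  define z where "z = add_mset (m + 1) y"
  have pos: "\<forall>p\<in>#x. 1 \<le> p" "\<forall>p\<in>#z. 1 \<le> p" and z: "set_mset z \<subseteq> {1..Suc m}"
    using x y by (auto simp: z_def)
  define t where "t = (m, dn z, image_mset Suc x)"
  have "m \<in># dn z \<or> m = 0" by (auto simp: in_dn_iff z_def)
  moreover have "set_mset (image_mset Suc x) \<subseteq> {1..m + a + 1}" "1 \<notin># image_mset Suc x"
    using x by auto
  moreover have "sum_mset (dn z) + size x = m + 1 + sum_mset y" "size (dn z) \<le> size x"
    using sum_dn[OF pos(2)] size size_dn_le[of z] by (simp_all add: z_def)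
  ultimately have "t \<in> {(k, x, y) \<in> durf_below a n. (k \<in># x \<or> k = 0) \<and> 1 \<notin># y}"
    using set_dn[OF z] n
    by (simp add: t_def durf_below_def sum_image_Suc algebra_simps)
  moreover have "size x = size z" using size by (simp add: z_def)
  then have "g t = s" using pos by (simp add: t_def g_def s dn_image_Suc up_dn) (simp add: z_def)
  ultimately show "\<exists>t\<in>{(k, x, y) \<in> durf_below a n. (k \<in># x \<or> k = 0) \<and> 1 \<notin># y}. g t = s" by blast
qed

lemma durf_above_lepoll_below:
  assumes "rect_src a n \<lesssim> rect_tgt a n"
  shows "durf_above a n \<lesssim> durf_below a n"
proof -
  let ?A1 = "{(k, x, y) \<in> durf_above a n. k + a + 1 \<notin># y}"
  let ?A2 = "{(k, x, y) \<in> durf_above a n. k + a + 1 \<in># y \<and> 1 \<in># x - {#k + 1#}}"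
  let ?A3 = "{(k, x, y) \<in> durf_above a n. k + a + 1 \<in># y \<and> 1 \<notin># x - {#k + 1#}}"
  let ?B1 = "{(k, x, y) \<in> durf_below a n. (k \<in># x \<or> k = 0) \<and> 1 \<in># y}"
  let ?B2 = "{(k, x, y) \<in> durf_below a n. \<not> (k \<in># x \<or> k = 0)}"
  let ?B3 = "{(k, x, y) \<in> durf_below a n. (k \<in># x \<or> k = 0) \<and> 1 \<notin># y}"
  have "?A3 \<lesssim> ?B3"
    using durf_above_lepoll_3 assms rect_tgt_lepoll by (meson lepoll_trans)
  then have "?A1 \<union> (?A2 \<union> ?A3) \<lesssim> ?B1 \<union> (?B2 \<union> ?B3)"
    by (intro Un_lepoll_mono durf_above_lepoll_1 durf_above_lepoll_2) (auto simp: disjnt_def)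
  also have "?B1 \<union> (?B2 \<union> ?B3) \<lesssim> durf_below a n" by (rule subset_imp_lepoll) auto
  also have "?A1 \<union> (?A2 \<union> ?A3) = durf_above a n" by auto
  finally show ?thesis .
qed

section \<open>Comparing rank and crank counts\<close>

lemma finite_partitions: "finite (partitions n)"
proof (induction n rule: less_induct)
  case (less n)
  have "partitions n \<subseteq> insert {#} (\<Union>p\<in>{1..n}. add_mset p ` partitions (n - p))"
  proof
    fix l assume l: "l \<in> partitions n"
    show "l \<in> insert {#} (\<Union>p\<in>{1..n}. add_mset p ` partitions (n - p))"
    proof (cases l)
      case (add p l')
      then have "p \<in> {1..n}" "l' \<in> partitions (n - p)" using l by (auto simp: partitions_def Suc_le_eq)
      then show ?thesis using add by auto
    qed simp
  qed
  moreover have "finite (insert {#} (\<Union>p\<in>{1..n}. add_mset p ` partitions (n - p)))"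
    using less by auto
  ultimately show ?case by (rule finite_subset)
qed

section \<open>Counting partitions by Durfee rectangles\<close>

lemma card_partitions_durf:
  assumes "1 \<le> j0 + c2" "\<And>l. l \<in> partitions n \<Longrightarrow> Q l \<Longrightarrow> j0 + c1 \<le> tail_count l (j0 + c2)"
  shows "card {l \<in> partitions n. Q l} = card {t \<in> durf c1 c2 j0 n. Q (of_durf c1 c2 t)}"
proof -
  note bij = bij_betw_of_durf[OF assms(1), of c1 n]
  have "{l \<in> partitions n. Q l} = of_durf c1 c2 ` {t \<in> durf c1 c2 j0 n. Q (of_durf c1 c2 t)}"
  proof (intro equalityI subsetI)
    fix l assume l: "l \<in> {l \<in> partitions n. Q l}"
    then have "l \<in> of_durf c1 c2 ` durf c1 c2 j0 n"
      using assms(2) bij by (simp add: bij_betw_def)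
    then show "l \<in> of_durf c1 c2 ` {t \<in> durf c1 c2 j0 n. Q (of_durf c1 c2 t)}" using l by auto
  next
    fix l assume "l \<in> of_durf c1 c2 ` {t \<in> durf c1 c2 j0 n. Q (of_durf c1 c2 t)}"
    then show "l \<in> {l \<in> partitions n. Q l}" using bij by (auto simp: bij_betw_def)
  qed
  moreover have "inj_on (of_durf c1 c2) {t \<in> durf c1 c2 j0 n. Q (of_durf c1 c2 t)}"
    using bij by (auto simp: bij_betw_def intro: inj_on_subset)
  ultimately show ?thesis by (simp add: card_image)
qed

lemma finite_durf: "1 \<le> j0 + c2 \<Longrightarrow> finite (durf c1 c2 j0 n)"
  using bij_betw_finite[OF bij_betw_of_durf, of j0 c2 c1 n] finite_partitions by simp

text \<open>With \<open>j + 1\<close> for the number of rows of the rectangle: triples whose \<open>x\<close> has no part of full height.\<close>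

definition durf_crank :: "nat \<Rightarrow> nat \<Rightarrow> (nat \<times> nat multiset \<times> nat multiset) set" where
  "durf_crank a n = {(j, x, y). set_mset x \<subseteq> {1..j} \<and> set_mset y \<subseteq> {1..j + a + 1}
     \<and> (j + 1) * (j + a + 1) + sum_mset x + sum_mset y = n}"

text \<open>Holds by \<open>(j + 1) * (j + a + 1) = j * (j + a + 2) + (a + 1)\<close>.\<close>

lemma durf_crank_shift:
  "durf_crank a (n + a + 1) = {(j, x, y) \<in> durf 0 (a + 2) 0 n. j + a + 2 \<notin># y}"
  by (auto simp: durf_crank_def durf_def algebra_simps subset_iff le_Suc_eq)

text \<open>A full row below a rectangle of \<open>j\<close> rows enlarges it to
  \<open>j + 1\<close> rows, and then no column of \<open>x\<close> has full height.\<close>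

lemma bij_betw_durf_crank_add:
  "bij_betw (\<lambda>(j, x, y). (j, x, add_mset (j + a + 2) y)) (durf_crank (a + 1) n)
    {(j, x, y) \<in> durf 0 (a + 2) 0 n. j + a + 2 \<in># y}"
proof (rule bij_betwI[where g = "\<lambda>(j, x, y). (j, x, y - {#j + a + 2#})"])
  show "(\<lambda>(j, x, y). (j, x, y - {#j + a + 2#})) \<in>
      {(j, x, y) \<in> durf 0 (a + 2) 0 n. j + a + 2 \<in># y} \<rightarrow> durf_crank (a + 1) n"
  proof (clarify, elim insert_DiffM[symmetric, elim_format])
    fix j x y assume y: "y = add_mset (j + a + 2) (y - {#j + a + 2#})" and "(j, x, y) \<in> durf 0 (a + 2) 0 n"
    then have "(j, x, add_mset (j + a + 2) (y - {#j + a + 2#})) \<in> durf 0 (a + 2) 0 n" by simp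
    then show "(j, x, y - {#j + a + 2#}) \<in> durf_crank (a + 1) n"
      by (simp add: durf_def durf_crank_def algebra_simps)
  qed
qed (auto simp: durf_def durf_crank_def algebra_simps)

text \<open>The recurrence for the crank counts: cut along a rectangle of \<open>j\<close> rows and
  \<open>j + a + 2\<close> columns and ask whether a full row lies below it.\<close>

lemma card_partitions_eq:
  "card (partitions n) = card (durf_crank a (n + a + 1)) + card (durf_crank (a + 1) n)"
proof -
  have "card (partitions n) = card (durf 0 (a + 2) 0 n)"
    using bij_betw_same_card[OF bij_betw_of_durf, of 0 "a + 2" 0 n] by simp
  also have "durf 0 (a + 2) 0 n = durf_crank a (n + a + 1) \<union> {(j, x, y) \<in> durf 0 (a + 2) 0 n. j + a + 2 \<in># y}"
    unfolding durf_crank_shift by auto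
  also have "card \<dots> = card (durf_crank a (n + a + 1)) + card {(j, x, y) \<in> durf 0 (a + 2) 0 n. j + a + 2 \<in># y}"
    unfolding durf_crank_shift
    by (rule card_Un_disjoint) (auto intro: finite_subset[OF _ finite_durf[of 0 "a + 2" 0 n]])
  also have "card {(j, x, y) \<in> durf 0 (a + 2) 0 n. j + a + 2 \<in># y} = card (durf_crank (a + 1) n)"
    by (rule bij_betw_same_card[OF bij_betw_durf_crank_add, symmetric])
  finally show ?thesis .
qed

lemma durf_crank_empty: "n < a + 1 \<Longrightarrow> durf_crank a n = {}"
  by (auto simp: durf_crank_def)

lemma finite_durf_crank: "finite (durf_crank a n)"
proof (cases "n < a + 1")
  case False
  then have "n = (n - a - 1) + a + 1" by simp
  then have "durf_crank a n \<subseteq> durf 0 (a + 2) 0 (n - a - 1)"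
    using durf_crank_shift[of a "n - a - 1"] by auto
  then show ?thesis by (rule finite_subset) (simp add: finite_durf)
qed (simp add: durf_crank_empty)

section \<open>Ranks of the triples and the two inequalities\<close>

lemma rank_of_durf:
  assumes "(j, x, y) \<in> durf 0 a 1 n"
  shows "rank (of_durf 0 a (j, x, y)) = int a + int (size x) - int (size y)"
  using assms largest_part_assemble[of x j y "j + a"] size_assemble[of x j "j + a" y]
  by (auto simp: rank_def of_durf_def durf_def set_mset_le_iff)

text \<open>Rank at least \<open>a + 1\<close> means \<open>|x| > |y|\<close>. Triples with
  \<open>j \<notin># x\<close> already lie in \<open>durf_crank\<close>; the others move to its
  triples with \<open>|x| \<le> |y|\<close>, so the images are disjoint.\<close>

lemma rank_ge_lepoll_durf_crank:
  assumes "\<And>n. rect_src a n \<lesssim> rect_tgt a n"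
  shows "{l \<in> partitions n. rank l \<ge> int a + 1} \<lesssim> durf_crank a n"
proof -
  let ?D = "durf 0 a 1 n"
  have "{l \<in> partitions n. rank l \<ge> int a + 1} \<lesssim> {(j, x, y) \<in> ?D. size y < size x}"
  proof (rule lepoll_by_inverse)
    fix l assume l: "l \<in> {l \<in> partitions n. rank l \<ge> int a + 1}"
    then have "a + 1 \<le> largest_part l" by (simp add: rank_def)
    then have "l \<in> of_durf 0 a ` ?D"
      using l bij_betw_of_durf[of 1 a 0 n] tail_count_pos_iff[of l "a + 1"] largest_part_ge_iff[of "a + 1" l]
      by (simp add: bij_betw_def Suc_le_eq)
    then obtain j x y where "(j, x, y) \<in> ?D" "of_durf 0 a (j, x, y) = l" by auto
    then show "\<exists>t\<in>{(j, x, y) \<in> ?D. size y < size x}. of_durf 0 a t = l"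
      using l rank_of_durf[of j x y a n] by force
  qed
  also have "{(j, x, y) \<in> ?D. size y < size x} = {(j, x, y) \<in> ?D. size y < size x \<and> j \<in># x} \<union>
      {(j, x, y) \<in> ?D. size y < size x \<and> j \<notin># x}" by auto
  also have "\<dots> \<lesssim> durf_below a n \<union> {(k, x, y) \<in> durf_crank a n. size y < size x}"
  proof (rule Un_lepoll_mono)
    have "{(j, x, y) \<in> ?D. size y < size x \<and> j \<in># x} \<lesssim> durf_above a n"
    proof (rule lepoll_by_inverse[where g = "\<lambda>(k, x, y). (k + 1, x, y)"], clarify)
      fix j x y assume *: "(j, x, y) \<in> ?D" "size y < size x" "j \<in># x"
      then have "j = j - 1 + 1" by (auto simp: durf_def)
      then obtain k where "j = k + 1" by metis
      with * show "\<exists>t\<in>durf_above a n. (\<lambda>(k, x, y). (k + 1, x, y)) t = (j, x, y)"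
        by (intro bexI[of _ "(k, x, y)"]) (auto simp: durf_def durf_above_def)
    qed
    then show "{(j, x, y) \<in> ?D. size y < size x \<and> j \<in># x} \<lesssim> durf_below a n"
      using durf_above_lepoll_below[OF assms] by (rule lepoll_trans)
    show "{(j, x, y) \<in> ?D. size y < size x \<and> j \<notin># x} \<lesssim> {(k, x, y) \<in> durf_crank a n. size y < size x}"
    proof (rule lepoll_by_inverse[where g = "\<lambda>(k, x, y). (k + 1, x, y)"], clarify)
      fix j x y assume *: "(j, x, y) \<in> ?D" "size y < size x" "j \<notin># x"
      then have "j = j - 1 + 1" by (auto simp: durf_def)
      then obtain k where "j = k + 1" by metis
      with * show "\<exists>t\<in>{(k, x, y) \<in> durf_crank a n. size y < size x}. (\<lambda>(k, x, y). (k + 1, x, y)) t = (j, x, y)"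
        by (intro bexI[of _ "(k, x, y)"]) (auto simp: durf_def durf_crank_def subset_iff le_Suc_eq)
    qed
    show "disjnt (durf_below a n) {(k, x, y) \<in> durf_crank a n. size y < size x}"
      by (auto simp: disjnt_def durf_below_def)
  qed
  also have "\<dots> \<lesssim> durf_crank a n"
    by (rule subset_imp_lepoll) (auto simp: durf_below_def durf_crank_def)
  finally show ?thesis .
qed

text \<open>Dyson's bijection: remove the first column and insert it as a new first row.\<close>

lemma rank_le_lepoll_rank_ge:
  "{m \<in> partitions n. rank m \<le> int a + 2} \<lesssim> {l \<in> partitions (n + a + 1). rank l \<ge> int a}"
proof (rule lepoll_by_inverse)
  define g where "g = (\<lambda>l. up (largest_part l - (a + 1)) (l - {#largest_part l#}))"
  fix m assume m: "m \<in> {m \<in> partitions n. rank m \<le> int a + 2}"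
  then have pos: "\<forall>p\<in>#m. 1 \<le> p" and sum: "sum_mset m = n"
    by (auto simp: partitions_def Suc_le_eq intro!: gr0I)
  \<comment> \<open>This is the rank bound; it makes the new row \<open>size m + a + 1\<close> the
    largest part once the first column is gone.\<close>
  have lm: "\<forall>p\<in>#m. p \<le> size m + a + 2" using m by (auto simp: rank_def simp flip: largest_part_le_iff)
  define l where "l = add_mset (size m + a + 1) (dn m)"
  have "\<forall>p\<in>#dn m. p \<le> size m + a + 1" using lm by (auto simp: in_dn_iff)
  then have lp: "largest_part l = size m + a + 1"
    by (intro antisym) (auto simp: l_def largest_part_le_iff largest_part_ge_iff)
  have "l \<in> partitions (n + a + 1)"
    using sum_dn[OF pos] sum by (auto simp: partitions_def l_def in_dn_iff)
  moreover have "rank l \<ge> int a" using size_dn_le[of m] by (simp add: rank_def lp) (simp add: l_def)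
  moreover have "g l = m" using up_dn[OF pos] by (simp add: g_def lp) (simp add: l_def)
  ultimately show "\<exists>l\<in>{l \<in> partitions (n + a + 1). rank l \<ge> int a}. g l = m" by blast
qed

lemma card_partitions_rank_split:
  "card (partitions n) = card {l \<in> partitions n. rank l \<ge> k + 1} + card {l \<in> partitions n. rank l \<le> k}"
proof -
  have "partitions n = {l \<in> partitions n. rank l \<ge> k + 1} \<union> {l \<in> partitions n. rank l \<le> k}" by auto
  then have "card (partitions n) = card ({l \<in> partitions n. rank l \<ge> k + 1} \<union> {l \<in> partitions n. rank l \<le> k})"
    by simp
  also have "\<dots> = card {l \<in> partitions n. rank l \<ge> k + 1} + card {l \<in> partitions n. rank l \<le> k}"
    by (rule card_Un_disjoint) (auto simp: finite_partitions)
  finally show ?thesis .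
qed

lemma durf_crank_card_le_rank_ge:
  assumes "\<And>a n. rect_src a n \<lesssim> rect_tgt a n"
  shows "card (durf_crank a n) \<le> card {l \<in> partitions n. rank l \<ge> int a}"
proof (cases "n < a + 1")
  case False
  define m where "m = n - (a + 1)"
  have n: "n = m + a + 1" using False by (simp add: m_def)
  \<comment> \<open>The bound \<open>a + 3\<close> is weakened to \<open>a + 2\<close>, where the
    first inequality applies with \<open>a + 1\<close>.\<close>
  have "card {l \<in> partitions m. rank l \<ge> int a + 3} \<le> card {l \<in> partitions m. rank l \<ge> int (a + 1) + 1}"
    by (rule card_mono) (auto simp: finite_partitions)
  also have "\<dots> \<le> card (durf_crank (a + 1) m)"
    using rank_ge_lepoll_durf_crank[OF assms, of m "a + 1"]
    by (subst (asm) lepoll_iff_card_le) (simp_all add: finite_partitions finite_durf_crank)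
  finally have "card (durf_crank a n) \<le> card {l \<in> partitions m. rank l \<le> int a + 2}"
    using card_partitions_eq[of m a] card_partitions_rank_split[of m "int a + 2"]
    unfolding n by (simp add: ac_simps)
  also have "\<dots> \<le> card {l \<in> partitions n. rank l \<ge> int a}"
    using rank_le_lepoll_rank_ge[of m a] unfolding n
    by (subst (asm) lepoll_iff_card_le) (simp_all add: finite_partitions)
  finally show ?thesis .
qed (simp add: durf_crank_empty)

lemma rank_conj: "0 \<notin># l \<Longrightarrow> rank (conj_mset l) = - rank l"
  by (simp add: rank_def size_conj largest_part_conj)

lemma card_rank_neg:
  "card {l \<in> partitions n. Q (- rank l)} = card {l \<in> partitions n. Q (rank l)}"
  by (rule bij_betw_same_card[of conj_mset], rule bij_betwI[where g = conj_mset])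
     (auto simp: partitions_def rank_conj zero_notin_conj sum_conj conj_conj)

section \<open>The distribution of the crank\<close>

lemma crank_alt:
  "crank l = (if count l 1 = 0 then int (largest_part l)
     else int (tail_count l (Suc (count l 1))) - int (count l 1))"
  by (simp only: crank_def Let_def tail_count_def Suc_le_eq)

lemma count_of_durf_wide:
  assumes "(j, x, y) \<in> durf 0 (a + 1) 0 n"
  shows "count (of_durf 0 (a + 1) (j, x, y)) 1 = count y 1"
proof (cases "j + a = 0")
  \<comment> \<open>The rectangle has width \<open>1\<close> but no rows, so it contributes no
    ones.\<close>
  case True
  then show ?thesis using assms by (auto simp: durf_def of_durf_def assemble_def conj_mset_def largest_part_def)
next
  case False
  then show ?thesis using count_assemble[of 1 "j + a + 1" j x y] by (simp add: of_durf_def)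
qed

text \<open>Let \<open>w = count y 1\<close>. If \<open>w \<ge> j + a + 1\<close>, at most
  \<open>j\<close> parts exceed \<open>w\<close>, so the crank is at most \<open>j - w\<close>.
  Otherwise at least \<open>j\<close> parts do, and it is at least \<open>-a\<close>.\<close>

lemma crank_of_durf_le_iff:
  assumes t: "(j, x, y) \<in> durf 0 (a + 1) 0 n"
  shows "crank (of_durf 0 (a + 1) (j, x, y)) \<le> - int (a + 1) \<longleftrightarrow> j + a + 1 \<le> count y 1"
proof -
  let ?l = "of_durf 0 (a + 1) (j, x, y)" and ?w = "count y 1"
  have r: "largest_part x \<le> j" "largest_part y \<le> j + a + 1" using t by (auto simp: durf_def set_mset_le_iff)
  note cr = crank_alt[of ?l, unfolded count_of_durf_wide[OF t]]
  show ?thesis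
  proof (cases "j + a + 1 \<le> ?w")
    case True
    then have "tail_count ?l (Suc ?w) \<le> j"
      using tail_count_assemble_gt[of x j "j + a + 1" "Suc ?w" y] r by (simp add: of_durf_def)
    then show ?thesis using True cr by simp
  next
    case False
    then have "j \<le> tail_count ?l (Suc ?w)"
      using tail_count_assemble_le[of x j "Suc ?w" "j + a + 1" y] r by (simp add: of_durf_def)
    then show ?thesis using False cr by simp
  qed
qed

text \<open>Removing \<open>j + a + 1\<close> ones makes room for one more row of the Durfee rectangle.\<close>

lemma card_crank_le:
  "card {l \<in> partitions n. crank l \<le> - int (a + 1)} = card (durf_crank a n)"
proof -
  have "card {l \<in> partitions n. crank l \<le> - int (a + 1)}
      = card {t \<in> durf 0 (a + 1) 0 n. crank (of_durf 0 (a + 1) t) \<le> - int (a + 1)}"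
    by (rule card_partitions_durf) auto
  also have "{t \<in> durf 0 (a + 1) 0 n. crank (of_durf 0 (a + 1) t) \<le> - int (a + 1)}
      = {(j, x, y) \<in> durf 0 (a + 1) 0 n. j + a + 1 \<le> count y 1}"
    using crank_of_durf_le_iff[of _ _ _ a n] by auto
  also have "card \<dots> = card (durf_crank a n)"
  proof (rule bij_betw_same_card, rule bij_betwI)
    show "(\<lambda>(j, x, y). (j, x, y - replicate_mset (j + a + 1) 1)) \<in>
        {(j, x, y) \<in> durf 0 (a + 1) 0 n. j + a + 1 \<le> count y 1} \<rightarrow> durf_crank a n"
    proof (clarify)
      fix j x y assume t: "(j, x, y) \<in> durf 0 (a + 1) 0 n" and c: "j + a + 1 \<le> count y 1"
      from c have "replicate_mset (j + a + 1) 1 \<subseteq># y" by (simp only: count_le_replicate_mset_subset_eq)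
      then obtain z where y: "y = replicate_mset (j + a + 1) 1 + z"
        by (metis mset_subset_eq_exists_conv)
      show "(j, x, y - replicate_mset (j + a + 1) 1) \<in> durf_crank a n"
        using t unfolding y by (auto simp: durf_def durf_crank_def)
    qed
    show "(\<lambda>(j, x, y). (j, x, replicate_mset (j + a + 1) 1 + y)) \<in>
        durf_crank a n \<rightarrow> {(j, x, y) \<in> durf 0 (a + 1) 0 n. j + a + 1 \<le> count y 1}"
    proof clarify
      fix j x y assume t: "(j, x, y) \<in> durf_crank a n"
      have "set_mset (replicate_mset (j + a + 1) 1 + y) \<subseteq> {1..j + (a + 1)}"
        using t by (auto simp: durf_crank_def in_replicate_mset subset_iff)
      then show "(j, x, replicate_mset (j + a + 1) 1 + y) \<in> durf 0 (a + 1) 0 n \<and>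
          j + a + 1 \<le> count (replicate_mset (j + a + 1) 1 + y) 1"
        using t by (simp add: durf_def durf_crank_def del: replicate_mset_Suc)
    qed
  next
    fix t assume "t \<in> {(j, x, y) \<in> durf 0 (a + 1) 0 n. j + a + 1 \<le> count y 1}"
    then obtain j x y where t: "t = (j, x, y)" and c: "j + a + 1 \<le> count y 1" by auto
    from c have "replicate_mset (j + a + 1) 1 \<subseteq># y" by (simp only: count_le_replicate_mset_subset_eq)
    then show "(\<lambda>(j, x, y). (j, x, replicate_mset (j + a + 1) 1 + y))
        ((\<lambda>(j, x, y). (j, x, y - replicate_mset (j + a + 1) 1)) t) = t"
      unfolding t prod.case by (simp only: subset_mset.add_diff_inverse)
  qed (auto simp: durf_crank_def)
  finally show ?thesis .
qed

section \<open>Positive cranks\<close>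

definition rest :: "nat \<Rightarrow> nat multiset \<Rightarrow> nat multiset" where
  "rest a x = filter_mset (\<lambda>p. p \<noteq> a) x"

lemma rest_simps [simp]:
  "rest a (x + y) = rest a x + rest a y" "a \<notin># rest a x" "count (rest a x) a = 0"
  "rest a (replicate_mset k b) = (if a = b then {#} else replicate_mset k b)"
  by (auto simp: rest_def filter_mset_eq_conv in_replicate_mset)

lemma rest_id: "a \<notin># x \<Longrightarrow> rest a x = x"
  by (auto simp: rest_def filter_mset_eq_conv)

lemma replicate_rest: "replicate_mset (count x a) a + rest a x = x"
  by (rule multiset_eqI) (simp add: rest_def)

lemma sum_rest: "count x a * a + sum_mset (rest a x) = sum_mset x"
  using arg_cong[OF replicate_rest, of sum_mset x a] by simp

lemma set_rest_subset: "set_mset (rest a x) \<subseteq> set_mset x"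
  by (simp add: rest_def)

lemma replicate_mset_add: "replicate_mset (m + n) a = replicate_mset m a + replicate_mset n a"
  by (induction m) auto

lemma triple_funcsetI: "(\<And>j x y. (j, x, y) \<in> A \<Longrightarrow> f (j, x, y) \<in> B) \<Longrightarrow> f \<in> A \<rightarrow> B"
  by auto

text \<open>An involution: \<open>x\<close> and \<open>y\<close> trade places, except that the ones
  of \<open>x\<close> stay. It brings partitions without ones to the tall rectangle used for those
  with ones.\<close>

lemma card_swap_ones:
  "card {(j, x, y) \<in> durf 0 a 1 n. 1 \<notin># y} = card {(j, x, y) \<in> durf a 0 1 n. 1 \<notin># y}"
proof -
  define f :: "nat \<times> nat multiset \<times> nat multiset \<Rightarrow> nat \<times> nat multiset \<times> nat multiset"
    where "f = (\<lambda>(j, x, y). (j, y + replicate_mset (count x 1) 1, rest 1 x))"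
  have inv: "f (f (j, x, y)) = (j, x, y)" if "1 \<notin># y" for j x y
    using that replicate_rest[of x 1] by (simp add: f_def not_in_iff rest_id add.commute)
  have mem: "f (j, x, y) \<in> {(j, x, y) \<in> durf c2 c1 1 n. 1 \<notin># y}" if "(j, x, y) \<in> durf c1 c2 1 n" for c1 c2 j x y
    using that sum_rest[of x 1] set_rest_subset[of 1 x]
    by (auto simp: f_def durf_def in_replicate_mset algebra_simps)
  have "bij_betw f {(j, x, y) \<in> durf 0 a 1 n. 1 \<notin># y} {(j, x, y) \<in> durf a 0 1 n. 1 \<notin># y}"
  proof (rule bij_betwI[where g = f])
    show "f \<in> {(j, x, y) \<in> durf 0 a 1 n. 1 \<notin># y} \<rightarrow> {(j, x, y) \<in> durf a 0 1 n. 1 \<notin># y}"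
      and "f \<in> {(j, x, y) \<in> durf a 0 1 n. 1 \<notin># y} \<rightarrow> {(j, x, y) \<in> durf 0 a 1 n. 1 \<notin># y}"
      by (intro triple_funcsetI mem; simp)+
  qed (use inv in auto)
  then show ?thesis by (rule bij_betw_same_card)
qed

text \<open>Division with remainder by \<open>j\<close>: each part \<open>j\<close> of \<open>y\<close> is split into \<open>j\<close> ones.\<close>

lemma card_trade_columns:
  "card {(j, x, y) \<in> durf a 0 1 n. count y 1 < j} = card {(j, x, y) \<in> durf a 0 1 n. j \<notin># y}"
proof -
  define f where "f = (\<lambda>(j, x :: nat multiset, y). (j, x, rest j y + replicate_mset (j * count y j) 1))"
  define g where "g = (\<lambda>(j, x :: nat multiset, y).
      (j, x, rest 1 y + replicate_mset (count y 1 mod j) 1 + replicate_mset (count y 1 div j) j))"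
  \<comment> \<open>For \<open>j = 1\<close>, ones and parts \<open>j\<close> coincide; in that case
    both sets only allow \<open>y = {#}\<close>.\<close>
  have one: "y = {#}" if "(1, x, y) \<in> durf a 0 1 n" "count y 1 = 0" for x y
  proof -
    have "set_mset y \<subseteq> {1}" "1 \<notin># y" using that by (auto simp: durf_def not_in_iff)
    then show ?thesis by (metis empty_iff insert_iff multiset_nonemptyE subsetD)
  qed
  have "bij_betw f {(j, x, y) \<in> durf a 0 1 n. count y 1 < j} {(j, x, y) \<in> durf a 0 1 n. j \<notin># y}"
  proof (rule bij_betwI[where g = g])
    have f: "f (j, x, y) \<in> {(j, x, y) \<in> durf a 0 1 n. j \<notin># y}"
      if t: "(j, x, y) \<in> durf a 0 1 n" "count y 1 < j" for j x y
    proof -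
      have "j \<notin># replicate_mset (j * count y j) 1"
        using t one[of x y] by (cases "j = 1") (auto simp: in_replicate_mset)
      moreover have "set_mset (rest j y + replicate_mset (j * count y j) 1) \<subseteq> {1..j}"
        using t(1) set_rest_subset[of j y] by (auto simp: durf_def in_replicate_mset subset_iff)
      moreover have "sum_mset (rest j y + replicate_mset (j * count y j) 1) = sum_mset y"
        using sum_rest[of y j] by (simp add: mult.commute)
      ultimately show ?thesis using t(1) by (simp add: f_def durf_def)
    qed
    show "f \<in> {(j, x, y) \<in> durf a 0 1 n. count y 1 < j} \<rightarrow> {(j, x, y) \<in> durf a 0 1 n. j \<notin># y}"
      by (intro triple_funcsetI f) simp_all
    have g: "g (j, x, y) \<in> {(j, x, y) \<in> durf a 0 1 n. count y 1 < j}"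
      if t: "(j, x, y) \<in> durf a 0 1 n" "j \<notin># y" for j x y
    proof -
      let ?y = "rest 1 y + replicate_mset (count y 1 mod j) 1 + replicate_mset (count y 1 div j) j"
      have j: "1 \<le> j" using t by (simp add: durf_def)
      have "count y j = 0" using t(2) by (simp only: not_in_iff)
      then have "count ?y 1 < j"
        using j by (cases "j = 1") auto
      moreover have "set_mset ?y \<subseteq> {1..j}"
        using t(1) set_rest_subset[of 1 y] by (auto simp: durf_def in_replicate_mset subset_iff)
      moreover have "sum_mset ?y = sum_mset y"
        using sum_rest[of y 1] by simp
      ultimately show ?thesis using t(1) by (simp add: g_def durf_def)
    qed
    show "g \<in> {(j, x, y) \<in> durf a 0 1 n. j \<notin># y} \<rightarrow> {(j, x, y) \<in> durf a 0 1 n. count y 1 < j}"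
      by (intro triple_funcsetI g) simp_all
  next
    fix t assume "t \<in> {(j, x, y) \<in> durf a 0 1 n. count y 1 < j}"
    then obtain j x y where t: "t = (j, x, y)" "(j, x, y) \<in> durf a 0 1 n" "count y 1 < j" by auto
    show "g (f t) = t"
    proof (cases "j = 1")
      case True
      then show ?thesis using t one[of x y] by (simp add: f_def g_def rest_def)
    next
      case False
      then have "count (rest j y) 1 = count y 1" by (simp add: rest_def)
      moreover have "rest 1 (rest j y) + replicate_mset (count y 1) 1 = rest j y"
        using replicate_rest[of "rest j y" 1] False by (simp add: rest_def add.commute)
      ultimately show ?thesis
        using t(3) False replicate_rest[of y j]
        by (simp add: f_def g_def t(1) add.commute)
    qed
  next
    fix t assume "t \<in> {(j, x, y) \<in> durf a 0 1 n. j \<notin># y}"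
    then obtain j x y where t: "t = (j, x, y)" "(j, x, y) \<in> durf a 0 1 n" "j \<notin># y" by auto
    show "f (g t) = t"
    proof (cases "j = 1")
      case True
      then show ?thesis using t one[of x y] by (simp add: f_def g_def rest_def not_in_iff)
    next
      case False
      have j: "count y j = 0" using t(3) by (simp only: not_in_iff)
      have "j \<notin># rest 1 y" using t(3) set_rest_subset[of 1 y] by blast
      define w where "w = count y 1"
      let ?y = "rest 1 y + replicate_mset (w mod j) 1 + replicate_mset (w div j) j"
      have "rest j ?y = rest 1 y + replicate_mset (w mod j) 1" "count ?y j = w div j"
        using False j \<open>j \<notin># rest 1 y\<close> by (simp_all add: rest_id) (simp add: rest_def)
      moreover have "g t = (j, x, ?y)" by (simp only: g_def t(1) prod.case w_def)
      ultimately have "f (g t) = (j, x, rest 1 y + replicate_mset (w mod j + j * (w div j)) 1)"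
        by (simp only: f_def prod.case replicate_mset_add add.assoc)
      also have "w mod j + j * (w div j) = w" by simp
      finally show ?thesis using replicate_rest[of y 1] by (simp add: t(1) w_def add.commute)
    qed
  qed
  then show ?thesis by (rule bij_betw_same_card)
qed


lemma card_durf_columns:
  "card {(j, x, y) \<in> durf a 0 1 n. j \<notin># y} = card (durf_crank a n)"
proof (rule bij_betw_same_card[symmetric], rule bij_betwI)
  show "(\<lambda>(k, x, y). (k + 1, y, x)) \<in> durf_crank a n \<rightarrow> {(j, x, y) \<in> durf a 0 1 n. j \<notin># y}"
    by (auto simp: durf_crank_def durf_def subset_iff algebra_simps)
  show "(\<lambda>(j, x, y). (j - 1, y, x)) \<in> {(j, x, y) \<in> durf a 0 1 n. j \<notin># y} \<rightarrow> durf_crank a n"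
  proof (intro triple_funcsetI)
    fix j x y assume t: "(j, x, y) \<in> {(j, x, y) \<in> durf a 0 1 n. j \<notin># y}"
    then obtain k where "j = Suc k" by (cases j) (auto simp: durf_def)
    then show "(\<lambda>(j, x, y). (j - 1, y, x)) (j, x, y) \<in> durf_crank a n"
      using t by (auto simp: durf_def durf_crank_def subset_iff le_Suc_eq algebra_simps)
  qed
qed (auto simp: durf_def)

text \<open>A part \<open>1\<close> and crank at least \<open>a + 1\<close> force
  \<open>j \<ge> 2\<close> columns, so all ones lie in \<open>y\<close>. If there are
  \<open>w\<close>, column \<open>w + 1\<close> has height at least \<open>w + a + 1\<close> exactly
  when \<open>w < j\<close>.\<close>

lemma card_crank_ge_with_ones:
  "card {l \<in> partitions n. 1 \<in># l \<and> crank l \<ge> int (a + 1)}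
    = card {(j, x, y) \<in> durf a 0 1 n. count y 1 < j \<and> 1 \<in># y}"
proof -
  have "card {l \<in> partitions n. 1 \<in># l \<and> crank l \<ge> int (a + 1)}
      = card {t \<in> durf a 0 2 n. 1 \<in># of_durf a 0 t \<and> crank (of_durf a 0 t) \<ge> int (a + 1)}"
  proof (rule card_partitions_durf)
    fix l assume l: "1 \<in># l \<and> crank l \<ge> int (a + 1)"
    then have c: "count l 1 \<ge> 1" by (simp add: Suc_le_eq)
    then have "count l 1 \<noteq> 0" by linarith
    then have "crank l = int (tail_count l (Suc (count l 1))) - int (count l 1)"
      by (simp only: crank_alt if_False)
    then have "count l 1 + a + 1 \<le> tail_count l (Suc (count l 1))" using l by linarith
    moreover have "tail_count l (Suc (count l 1)) \<le> tail_count l 2"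
      using c by (intro tail_count_antimono) linarith
    ultimately have "2 + a \<le> tail_count l 2" using c by linarith
    then show "2 + a \<le> tail_count l (2 + 0)" by simp
  qed simp
  also have "{t \<in> durf a 0 2 n. 1 \<in># of_durf a 0 t \<and> crank (of_durf a 0 t) \<ge> int (a + 1)}
      = {(j, x, y) \<in> durf a 0 1 n. count y 1 < j \<and> 1 \<in># y}"
  proof -
    have "(1 \<in># of_durf a 0 (j, x, y) \<and> crank (of_durf a 0 (j, x, y)) \<ge> int (a + 1))
        \<longleftrightarrow> count y 1 < j \<and> 1 \<in># y" if t: "(j, x, y) \<in> durf a 0 2 n" for j x y
    proof -
      let ?l = "of_durf a 0 (j, x, y)" and ?w = "count y 1"
      have r: "largest_part x \<le> j + a" "largest_part y \<le> j" "2 \<le> j"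
        using t by (auto simp: durf_def set_mset_le_iff)
      have c: "count ?l 1 = ?w"
        using count_assemble[of 1 j "j + a" x y] r by (simp add: of_durf_def)
      then have one: "1 \<in># ?l \<longleftrightarrow> 1 \<in># y" by (metis not_in_iff)
      show ?thesis
      proof (cases "1 \<in># y")
        case True
        then have "?w \<noteq> 0" by simp
        then have "crank ?l \<ge> int (a + 1) \<longleftrightarrow> ?w + a + 1 \<le> tail_count ?l (Suc ?w)"
          unfolding crank_alt c if_not_P[OF \<open>?w \<noteq> 0\<close>] by linarith
        moreover have "?w + a + 1 \<le> tail_count ?l (Suc ?w) \<longleftrightarrow> ?w < j"
          using tail_count_assemble_le[of x "j + a" "Suc ?w" j y]
            tail_count_assemble_gt[of x "j + a" j "Suc ?w" y] r
          by (cases "?w < j") (auto simp: of_durf_def)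
        ultimately show ?thesis using one True by simp
      qed (use one in simp)
    qed
    moreover have "(j, x, y) \<in> durf a 0 1 n \<and> count y 1 < j \<and> 1 \<in># y
        \<longleftrightarrow> (j, x, y) \<in> durf a 0 2 n \<and> count y 1 < j \<and> 1 \<in># y" for j x y
      by (auto simp: durf_def simp flip: count_greater_zero_iff)
    ultimately show ?thesis by auto
  qed
  finally show ?thesis .
qed

text \<open>Without ones the crank is the largest part \<open>j + a + |x|\<close>, which always
  reaches \<open>a + 1\<close>.\<close>

lemma card_crank_ge_without_ones:
  assumes "n \<ge> 2"
  shows "card {l \<in> partitions n. 1 \<notin># l \<and> crank l \<ge> int (a + 1)}
    = card {(j, x, y) \<in> durf 0 a 1 n. 1 \<notin># y}"
proof -
  have cr: "crank l = int (largest_part l)" if "1 \<notin># l" for l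
    using that by (simp only: crank_alt not_in_iff if_True simp_thms)
  have "card {l \<in> partitions n. 1 \<notin># l \<and> crank l \<ge> int (a + 1)}
      = card {t \<in> durf 0 a 1 n. 1 \<notin># of_durf 0 a t \<and> crank (of_durf 0 a t) \<ge> int (a + 1)}"
  proof (rule card_partitions_durf)
    fix l assume l: "1 \<notin># l \<and> crank l \<ge> int (a + 1)"
    then have "crank l = int (largest_part l)" using cr by blast
    then have "a + 1 \<le> largest_part l" using l by linarith
    then show "1 + 0 \<le> tail_count l (1 + a)"
      using tail_count_pos_iff[of l "a + 1"] largest_part_ge_iff[of "a + 1" l] by (simp add: Suc_le_eq)
  qed simp
  also have "{t \<in> durf 0 a 1 n. 1 \<notin># of_durf 0 a t \<and> crank (of_durf 0 a t) \<ge> int (a + 1)}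
      = {(j, x, y) \<in> durf 0 a 1 n. 1 \<notin># y}"
  proof -
    have "(1 \<notin># of_durf 0 a (j, x, y) \<and> crank (of_durf 0 a (j, x, y)) \<ge> int (a + 1))
        \<longleftrightarrow> 1 \<notin># y" if t: "(j, x, y) \<in> durf 0 a 1 n" for j x y
    proof -
      let ?l = "of_durf 0 a (j, x, y)"
      have r: "largest_part x \<le> j" "largest_part y \<le> j + a" "1 \<le> j" "0 \<notin># x"
        using t by (auto simp: durf_def set_mset_le_iff)
      have "largest_part ?l = j + a + size x"
        using largest_part_assemble[of x j y "j + a"] r by (simp add: of_durf_def)
      then have "crank ?l \<ge> int (a + 1)" if "1 \<notin># ?l" using r(3) cr[OF that] by simp
      moreover have "1 \<in># ?l \<longleftrightarrow> 1 \<in># y"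
      proof (cases "j + a = 1")
        case False
        then have "count ?l 1 = count y 1"
          using count_assemble[of 1 "j + a" j x y] r by (simp add: of_durf_def)
        then show ?thesis by (metis not_in_iff)
      next
        \<comment> \<open>A rectangle of one cell is a part \<open>1\<close> unless a column stands
          to its right; \<open>n \<ge> 2\<close> provides one when \<open>y\<close> is
          empty.\<close>
        case True
        then have ja: "j = 1" "a = 0" using r(3) by auto
        have "y = {#} \<or> 1 \<in># y"
          using r(2) t ja by (auto simp: durf_def)
        moreover have "1 \<notin># ?l" if "y = {#}"
        proof -
          have "x \<noteq> {#}" using t ja that assms by (auto simp: durf_def)
          then have "largest_part x \<noteq> 0" using r(4) largest_part_le_iff[of x 0]
            by (metis le_zero_eq multiset_nonemptyE)
          then have "replicate_mset (1 - largest_part x) (1::nat) = {#}" by simp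
          then show ?thesis
            using that ja zero_notin_conj[of x] by (auto simp: of_durf_def assemble_def)
        qed
        moreover have "1 \<in># ?l" if "1 \<in># y" using that by (simp add: of_durf_def assemble_def)
        ultimately show ?thesis by blast
      qed
      ultimately show ?thesis by blast
    qed
    then show ?thesis by auto
  qed
  finally show ?thesis .
qed

lemma card_crank_ge:
  assumes "n \<ge> 2"
  shows "card {l \<in> partitions n. crank l \<ge> int (a + 1)} = card (durf_crank a n)"
proof -
  have fin: "finite (durf a 0 1 n)" by (rule finite_durf) simp
  have "{l \<in> partitions n. crank l \<ge> int (a + 1)} = {l \<in> partitions n. 1 \<notin># l \<and> crank l \<ge> int (a + 1)}
      \<union> {l \<in> partitions n. 1 \<in># l \<and> crank l \<ge> int (a + 1)}" by auto
  then have "card {l \<in> partitions n. crank l \<ge> int (a + 1)} =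
      card {l \<in> partitions n. 1 \<notin># l \<and> crank l \<ge> int (a + 1)} + card {l \<in> partitions n. 1 \<in># l \<and> crank l \<ge> int (a + 1)}"
    using finite_partitions[of n] by (simp only:) (rule card_Un_disjoint, auto)
  also have "\<dots> = card {(j, x, y) \<in> durf a 0 1 n. 1 \<notin># y} + card {(j, x, y) \<in> durf a 0 1 n. count y 1 < j \<and> 1 \<in># y}"
    by (simp only: card_crank_ge_without_ones[OF assms] card_crank_ge_with_ones card_swap_ones)
  also have "\<dots> = card ({(j, x, y) \<in> durf a 0 1 n. 1 \<notin># y} \<union> {(j, x, y) \<in> durf a 0 1 n. count y 1 < j \<and> 1 \<in># y})"
    by (rule card_Un_disjoint[symmetric]) (auto intro: finite_subset[OF _ fin])
  also have "{(j, x, y) \<in> durf a 0 1 n. 1 \<notin># y} \<union> {(j, x, y) \<in> durf a 0 1 n. count y 1 < j \<and> 1 \<in># y}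
      = {(j, x, y) \<in> durf a 0 1 n. count y 1 < j}"
    by (auto simp: durf_def not_in_iff)
  also have "card \<dots> = card (durf_crank a n)"
    by (simp only: card_trade_columns card_durf_columns)
  finally show ?thesis .
qed

lemma rect_src_lepoll_rect_tgt: "rect_src a n \<lesssim> rect_tgt a n"
proof -
  consider "a = 0" | "a = 1" | "a \<ge> 2" by linarith
  then show ?thesis
    using rect_src_lepoll_0 rect_src_lepoll_1 rect_src_lepoll_large by cases auto
qed

lemma card_rank_ge_le: "card {l \<in> partitions n. rank l \<ge> int (a + 1)} \<le> card (durf_crank a n)"
  using rank_ge_lepoll_durf_crank[OF rect_src_lepoll_rect_tgt, of n a]
  by (subst (asm) lepoll_iff_card_le) (simp_all add: finite_partitions finite_durf_crank add.commute)

lemma card_rank_ge_ge: "card (durf_crank a n) \<le> card {l \<in> partitions n. rank l \<ge> int a}"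
  by (rule durf_crank_card_le_rank_ge[OF rect_src_lepoll_rect_tgt])

section \<open>Positions in the sorted lists\<close>

text \<open>If \<open>g (ys ! i) > j\<close>, at most \<open>i\<close> entries have
  \<open>g \<le> j\<close>, whereas the first \<open>i + 1\<close> entries of \<open>xs\<close> all
  have \<open>f \<le> k\<close>.\<close>

lemma sorted_position_le:
  fixes f g :: "'a \<Rightarrow> int"
  assumes xs: "distinct xs" "sorted (map f xs)" and ys: "distinct ys" "sorted (map g ys)"
    and "set xs = set ys" and card: "card {l \<in> set xs. f l \<le> k} \<le> card {l \<in> set xs. g l \<le> j}"
    and i: "i < length xs" and le: "f (xs ! i) \<le> k"
  shows "g (ys ! i) \<le> j"
proof (rule ccontr)
  assume gt: "\<not> g (ys ! i) \<le> j"
  have len: "length xs = length ys" using assms(1,3,5) by (metis distinct_card)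
  have "f (xs ! m) \<le> k" if "m \<le> i" for m
    using sorted_nth_mono[OF xs(2), of m i] that i le by simp
  then have "set (take (Suc i) xs) \<subseteq> {l \<in> set xs. f l \<le> k}"
    using i by (fastforce simp: set_conv_nth[of "take (Suc i) xs"] less_Suc_eq_le)
  then have "card (set (take (Suc i) xs)) \<le> card {l \<in> set xs. f l \<le> k}"
    by (intro card_mono) auto
  moreover have "card (set (take (Suc i) xs)) = Suc i"
    using i xs(1) by (simp add: distinct_card)
  moreover have "{l \<in> set ys. g l \<le> j} \<subseteq> set (take i ys)"
  proof
    fix l assume "l \<in> {l \<in> set ys. g l \<le> j}"
    then obtain m where m: "m < length ys" "l = ys ! m" "g (ys ! m) \<le> j" by (auto simp: in_set_conv_nth)
    have "\<not> i \<le> m"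
      using sorted_nth_mono[OF ys(2), of i m] m gt by auto
    then show "l \<in> set (take i ys)" using m by (auto simp: in_set_conv_nth intro!: exI[of _ m])
  qed
  then have "card {l \<in> set ys. g l \<le> j} \<le> card (set (take i ys))" by (intro card_mono) auto
  moreover have "card (set (take i ys)) \<le> i" using card_length[of "take i ys"] by simp
  ultimately show False using card \<open>set xs = set ys\<close> by simp
qed

text \<open>Reversing both lists and negating \<open>f\<close> and \<open>g\<close> reduces this to
  \<open>sorted_position_le\<close>.\<close>

lemma sorted_position_ge:
  fixes f g :: "'a \<Rightarrow> int"
  assumes xs: "distinct xs" "sorted (map f xs)" and ys: "distinct ys" "sorted (map g ys)"
    and eq: "set xs = set ys" and card: "card {l \<in> set xs. k \<le> f l} \<le> card {l \<in> set xs. j \<le> g l}"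
    and i: "i < length xs" and ge: "k \<le> f (xs ! i)"
  shows "j \<le> g (ys ! i)"
proof -
  have len: "length xs = length ys" using assms(1,3,5) by (metis distinct_card)
  have rev: "rev zs ! (length zs - Suc i) = zs ! i" if "i < length zs" for zs :: "'a list"
    using that by (simp add: rev_nth)
  have sorted: "sorted (map (\<lambda>l. - h l) (rev zs))" if "sorted (map h zs)" for h :: "'a \<Rightarrow> int" and zs
    using that by (simp add: sorted_map sorted_wrt_rev)
  have "- g (rev ys ! (length xs - Suc i)) \<le> - j"
    by (rule sorted_position_le[of "rev xs" "\<lambda>l. - f l" "rev ys" "\<lambda>l. - g l" "- k"])
       (use assms rev[of xs] sorted[OF xs(2)] sorted[OF ys(2)] in simp_all)
  then show ?thesis using rev[of ys] i len by simp
qed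

text \<open>For \<open>n = 1\<close> the crank counts are not symmetric; as the only crank is
  negative, a nonnegative crank allows \<open>n \<ge> 2\<close> to be assumed.\<close>

lemma crank_neg_partition_1:
  assumes "l \<in> partitions 1"
  shows "crank l < 0"
proof (cases l)
  case (add p l')
  then have p: "0 < p" "p + sum_mset l' = 1" "0 \<notin># l'"
    using assms by (auto simp: partitions_def)
  have "l' = {#}"
  proof (cases l')
    case (add q l'')
    then show ?thesis using p by auto
  qed
  moreover from this have "p = 1" using p by simp
  ultimately show ?thesis by (simp add: add crank_def)
qed (use assms in \<open>simp add: partitions_def\<close>)

theorem theorem1p5:
  fixes n :: nat and cl rl :: "nat multiset list"
  assumes "n \<ge> 1"
    and "distinct cl" and "set cl = partitions n" and "sorted (map crank cl)"
    and "distinct rl" and "set rl = partitions n" and "sorted (map rank rl)"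
  shows "\<forall>i < length cl.
           (crank (cl ! i) = 0 \<longrightarrow> crank (cl ! i) - rank (rl ! i) = 0) \<and>
           (crank (cl ! i) > 0 \<longrightarrow> crank (cl ! i) - rank (rl ! i) \<in> {0, 1}) \<and>
           (crank (cl ! i) < 0 \<longrightarrow> crank (cl ! i) - rank (rl ! i) \<in> {0, -1})"
proof (intro allI impI)
  fix i assume i: "i < length cl"
  define c r where "c = crank (cl ! i)" and "r = rank (rl ! i)"
  have sets: "set cl = set rl" "set rl = set cl" using assms by simp_all
  have ir: "i < length rl" using i assms(2,5) sets by (metis distinct_card)
  note c_to_r_le = sorted_position_le[OF assms(2,4,5,7) sets(1) _ i, folded c_def r_def, unfolded assms(3)]
  note r_to_c_le = sorted_position_le[OF assms(5,7,2,4) sets(2) _ ir, folded c_def r_def, unfolded assms(6)]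
  note c_to_r_ge = sorted_position_ge[OF assms(2,4,5,7) sets(1) _ i, folded c_def r_def, unfolded assms(3)]
  note r_to_c_ge = sorted_position_ge[OF assms(5,7,2,4) sets(2) _ ir, folded c_def r_def, unfolded assms(6)]
  have neg: "card {l \<in> partitions n. rank l \<le> - int b} = card {l \<in> partitions n. rank l \<ge> int b}" for b
    using card_rank_neg[of n "\<lambda>k. k \<ge> int b"] by (simp add: le_minus_iff)
  \<comment> \<open>The two inequalities at position \<open>i\<close>, on either side of zero: a
    crank bound \<open>a + 1\<close> gives the rank bound \<open>a\<close>, and a rank bound
    \<open>a + 1\<close> gives the crank bound \<open>a + 1\<close>.\<close>
  have low1: "r \<le> - int a" if "c \<le> - int (a + 1)" for a
    by (rule c_to_r_le[OF _ that]) (simp only: card_crank_le neg card_rank_ge_ge)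
  have low2: "c \<le> - int (a + 1)" if "r \<le> - int (a + 1)" for a
    by (rule r_to_c_le[OF _ that]) (simp only: card_crank_le neg card_rank_ge_le)
  have n: "n \<ge> 2" if "0 \<le> c"
  proof -
    have "n \<noteq> 1" using crank_neg_partition_1[of "cl ! i"] assms(3) nth_mem[OF i] that by (auto simp: c_def)
    then show ?thesis using assms(1) by simp
  qed
  have high1: "r \<ge> int a" if "c \<ge> int (a + 1)" for a
    by (rule c_to_r_ge[OF _ that]) (use n that in \<open>simp only: card_crank_ge card_rank_ge_ge\<close>)
  have high2: "c \<ge> int (a + 1)" if "r \<ge> int (a + 1)" "0 \<le> c" for a
    by (rule r_to_c_ge[OF _ that(1)]) (simp only: card_crank_ge[OF n[OF that(2)]] card_rank_ge_le)
  have "c = int (nat (c - 1) + 1)" if "0 < c" using that by simp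
  moreover have "c = - int (nat (- c - 1) + 1)" if "c < 0" using that by simp
  ultimately consider "c = 0" | a where "c = int (a + 1)" | a where "c = - int (a + 1)"
    by (meson linorder_less_linear)
  then show "(c = 0 \<longrightarrow> c - r = 0) \<and> (c > 0 \<longrightarrow> c - r \<in> {0, 1}) \<and> (c < 0 \<longrightarrow> c - r \<in> {0, -1})"
  proof cases
    case 1
    then have "\<not> r \<le> - 1" "\<not> r \<ge> 1" using low2[of 0] high2[of 0] by auto
    then show ?thesis using 1 by auto
  next
    case 2
    then have "r \<ge> int a" "\<not> r \<ge> int (a + 2)" using high1[of a] high2[of "a + 1"] by auto
    then show ?thesis using 2 by auto
  next
    case 3
    then have "r \<le> - int a" "\<not> r \<le> - int (a + 2)" using low1[of a] low2[of "a + 1"] by auto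
    then show ?thesis using 3 by auto
  qed
qed

end
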